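(* Let $\nabla$ be a connection on a smooth manifold $M$. For every $\varphi\in\Upsilon^r(M)$, we have $$\widetilde{\nabla^s\varphi}=X_\nabla\tilde{\varphi}.$$
   Context: $M$ is a smooth manifold of positive dimension, and a connection on $M$ is an affine connection on $TM$ (not necessarily torsion-free), also extended to tensor fields. $\Upsilon^r(M)=\Gamma(\mathrm{Sym}^rT^*M)$ is the space of totally symmetric covariant $r$-tensor fields, with $\Upsilon^0(M)=C^\infty(M)$. The symmetric derivative $\nabla^s:\Upsilon^r(M)\to\Upsilon^{r+1}(M)$ is given by $\nabla^sf=df$ on functions and $$(\nabla^s\varphi)(X_1,\dots,X_{r+1})=\sum_{j=1}^{r+1}(\nabla_{X_j}\varphi)(X_1,\dots,\hat{X}_j,\dots,X_{r+1}).$$ For $\varphi\in\Upsilon^r(M)$, the function $\tilde\varphi\in C^\infty(TM)$ is $\tilde\varphi(u)=\frac{1}{r!}\varphi(u,\dots,u)$ for $r>0$, and $\tilde f=\mathrm{pr}^*f$ for $r=0$, where $\mathrm{pr}:TM\to M$ is the projection. The geodesic spray $X_\nabla\in\mathfrak{X}(TM)$ is the vector field whose value at $u\in TM$ is the horizontal lift of $u$ to $T_uTM$ with respect to $\nabla$; in natural coordinates $\{x^i\}\cup\{v^j\}$ on $TM$, $X_\nabla=v^i\partial_{x^i}-v^iv^j\,\mathrm{pr}^*\Gamma^k_{ij}\,\partial_{v^k}$, where $\Gamma^k_{ij}$ are the Christoffel symbols. $X_\nabla\tilde\varphi$ is the derivative of $\tilde\varphi$ along $X_\nabla$. *)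

theory Defs
  imports "HOL-Analysis.Analysis" "HOL-Library.Multiset"
begin

section \<open>Smooth functions on open subsets of a Euclidean space\<close>

primrec Ck_on ::
  "nat \<Rightarrow> 'e::euclidean_space set \<Rightarrow> ('e \<Rightarrow> 'f::real_normed_vector) \<Rightarrow> bool" where
  "Ck_on 0 S f \<longleftrightarrow> continuous_on S f"
| "Ck_on (Suc k) S f \<longleftrightarrow> (\<forall>x\<in>S. f differentiable (at x)) \<and>
     (\<forall>b\<in>Basis. Ck_on k S (\<lambda>x. frechet_derivative f (at x) b))"

definition smooth_on ::
  "'e::euclidean_space set \<Rightarrow> ('e \<Rightarrow> 'f::real_normed_vector) \<Rightarrow> bool" where
  "smooth_on S f \<longleftrightarrow> open S \<and> (\<forall>k. Ck_on k S f)"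


section \<open>Smooth manifolds\<close>

text \<open>A chart is a domain together with a coordinate map, which is only relevant on the domain.
  The model space is a Euclidean space, so it has positive dimension. The smooth structure is given
  by an atlas that need not be maximal.\<close>

type_synonym ('a, 'e) chart = "'a set \<times> ('a \<Rightarrow> 'e)"

locale smooth_manifold =
  fixes T :: "'a topology" and A :: "('a, 'e::euclidean_space) chart set"
  assumes Hausdorff: "Hausdorff_space T"
    and second_countable: "second_countable T"
    and charts_cover: "(\<Union>(U, x)\<in>A. U) = topspace T"
    and chart_domain: "(U, x) \<in> A \<Longrightarrow> openin T U"
    and chart_image: "(U, x) \<in> A \<Longrightarrow> open (x ` U)"
    and chart_homeomorphic: "(U, x) \<in> A \<Longrightarrow>
      homeomorphic_map (subtopology T U) (top_of_set (x ` U)) x"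
    and smooth_transition: "(U, x) \<in> A \<Longrightarrow> (V, y) \<in> A \<Longrightarrow>
      smooth_on (x ` (U \<inter> V)) (y \<circ> inv_into U x)"

definition points :: "('a, 'e) chart set \<Rightarrow> 'a set" where
  "points A = (\<Union>(U, x)\<in>A. U)"

text \<open>\<open>smooth_near A p f\<close>: the function \<open>f\<close> is smooth on a neighbourhood of \<open>p\<close>.\<close>

definition smooth_near ::
  "('a, 'e::euclidean_space) chart set \<Rightarrow> 'a \<Rightarrow> ('a \<Rightarrow> real) \<Rightarrow> bool" where
  "smooth_near A p f \<longleftrightarrow> (\<exists>(U, x)\<in>A. \<exists>W. p \<in> U \<and> x p \<in> W \<and> W \<subseteq> x ` U \<and>
     smooth_on W (f \<circ> inv_into U x))"

definition smooth_functions ::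
  "('a, 'e::euclidean_space) chart set \<Rightarrow> ('a \<Rightarrow> real) set" where
  "smooth_functions A = {f. \<forall>p\<in>points A. smooth_near A p f}"


section \<open>Tangent vectors and the tangent bundle\<close>

text \<open>A tangent vector at \<open>p\<close> is a derivation of the functions that are smooth near \<open>p\<close>. To make
  equality of tangent vectors equality of HOL functions, it is required to be \<open>0\<close> on all
  other functions. Such a derivation depends on the germ at \<open>p\<close> only: if \<open>f\<close> vanishes near \<open>p\<close>,
  then \<open>f = f * h\<close>, where \<open>h\<close> is \<open>0\<close> near \<open>p\<close> and \<open>1\<close> elsewhere.\<close>

type_synonym 'a tangent = "('a \<Rightarrow> real) \<Rightarrow> real"

definition tangent_space ::
  "('a, 'e::euclidean_space) chart set \<Rightarrow> 'a \<Rightarrow> 'a tangent set" where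
  "tangent_space A p = {v.
     (\<forall>f. \<not> smooth_near A p f \<longrightarrow> v f = 0) \<and>
     (\<forall>f g. smooth_near A p f \<longrightarrow> smooth_near A p g \<longrightarrow> v (\<lambda>q. f q + g q) = v f + v g) \<and>
     (\<forall>c f. smooth_near A p f \<longrightarrow> v (\<lambda>q. c * f q) = c * v f) \<and>
     (\<forall>f g. smooth_near A p f \<longrightarrow> smooth_near A p g \<longrightarrow>
        v (\<lambda>q. f q * g q) = v f * g p + f p * v g)}"

text \<open>The coordinate vector \<open>\<partial>/\<partial>x\<^sup>b\<close> at \<open>p\<close>.\<close>

definition coord_vector ::
  "('a, 'e::euclidean_space) chart set \<Rightarrow> ('a, 'e) chart \<Rightarrow> 'e \<Rightarrow> 'a \<Rightarrow> 'a tangent" where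
  "coord_vector A = (\<lambda>(U, x) b p f.
     if smooth_near A p f then frechet_derivative (f \<circ> inv_into U x) (at (x p)) b else 0)"

text \<open>The atlas of natural charts on the tangent bundle: the coordinates of \<open>(p, v)\<close> are \<open>x p\<close> and
  the components \<open>v(x\<^sup>b)\<close> of \<open>v\<close> with respect to the coordinate vectors.\<close>

definition natural_chart ::
  "('a, 'e::euclidean_space) chart set \<Rightarrow> ('a, 'e) chart \<Rightarrow> ('a \<times> 'a tangent, 'e \<times> 'e) chart" where
  "natural_chart A = (\<lambda>(U, x).
     (SIGMA p:U. tangent_space A p,
      \<lambda>(p, v). (x p, \<Sum>b\<in>Basis. v (\<lambda>q. x q \<bullet> b) *\<^sub>R b)))"

definition tangent_atlas ::
  "('a, 'e::euclidean_space) chart set \<Rightarrow> ('a \<times> 'a tangent, 'e \<times> 'e) chart set" where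
  "tangent_atlas A = natural_chart A ` A"

definition tangent_bundle ::
  "('a, 'e::euclidean_space) chart set \<Rightarrow> ('a \<times> 'a tangent) set" where
  "tangent_bundle A = (SIGMA p:points A. tangent_space A p)"

text \<open>The differential at \<open>p\<close> of a smooth map \<open>\<Phi>\<close> into the manifold with atlas \<open>B\<close>.\<close>

definition differential ::
  "('b, 'f::euclidean_space) chart set \<Rightarrow> ('a \<Rightarrow> 'b) \<Rightarrow> 'a \<Rightarrow> 'a tangent \<Rightarrow> 'b tangent" where
  "differential B \<Phi> p v = (\<lambda>F. if smooth_near B (\<Phi> p) F then v (F \<circ> \<Phi>) else 0)"


section \<open>Vector fields and symmetric tensor fields\<close>

text \<open>Vector fields are \<open>0\<close> outside the manifold, so that equal vector fields are equal HOL functions.\<close>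

type_synonym 'a field = "'a \<Rightarrow> 'a tangent"

definition vector_fields :: "('a, 'e::euclidean_space) chart set \<Rightarrow> 'a field set" where
  "vector_fields A = {X.
     (\<forall>p\<in>points A. X p \<in> tangent_space A p) \<and>
     (\<forall>p. p \<notin> points A \<longrightarrow> X p = (\<lambda>_. 0)) \<and>
     (\<forall>(U, x)\<in>A. \<forall>b\<in>Basis. \<forall>p\<in>U. smooth_near A p (\<lambda>q. X q (\<lambda>q'. x q' \<bullet> b)))}"

definition field_add :: "'a field \<Rightarrow> 'a field \<Rightarrow> 'a field" where
  "field_add X Y = (\<lambda>p f. X p f + Y p f)"

definition field_scale :: "('a \<Rightarrow> real) \<Rightarrow> 'a field \<Rightarrow> 'a field" where
  "field_scale h X = (\<lambda>p f. h p * X p f)"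

text \<open>A covariant \<open>r\<close>-tensor at a point takes a list of \<open>r\<close> tangent vectors; in particular, a
  \<open>0\<close>-tensor field \<open>\<phi>\<close> is the function \<open>\<lambda>p. \<phi> p []\<close>.\<close>

type_synonym 'a tensor_field = "'a \<Rightarrow> 'a tangent list \<Rightarrow> real"

definition sym_tensor ::
  "('a, 'e::euclidean_space) chart set \<Rightarrow> nat \<Rightarrow> 'a \<Rightarrow> ('a tangent list \<Rightarrow> real) \<Rightarrow> bool" where
  "sym_tensor A r p \<tau> \<longleftrightarrow>
     (\<forall>vs j v w. vs \<in> lists (tangent_space A p) \<longrightarrow> length vs = r \<longrightarrow> j < r \<longrightarrow>
        v \<in> tangent_space A p \<longrightarrow> w \<in> tangent_space A p \<longrightarrow>
        \<tau> (vs[j := (\<lambda>f. v f + w f)]) = \<tau> (vs[j := v]) + \<tau> (vs[j := w])) \<and>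
     (\<forall>vs j v c. vs \<in> lists (tangent_space A p) \<longrightarrow> length vs = r \<longrightarrow> j < r \<longrightarrow>
        v \<in> tangent_space A p \<longrightarrow>
        \<tau> (vs[j := (\<lambda>f. c * v f)]) = c * \<tau> (vs[j := v])) \<and>
     (\<forall>vs ws. vs \<in> lists (tangent_space A p) \<longrightarrow> length vs = r \<longrightarrow> mset ws = mset vs \<longrightarrow>
        \<tau> ws = \<tau> vs)"

definition sym_tensor_fields ::
  "('a, 'e::euclidean_space) chart set \<Rightarrow> nat \<Rightarrow> 'a tensor_field set" where
  "sym_tensor_fields A r = {\<phi>.
     (\<forall>p\<in>points A. sym_tensor A r p (\<phi> p)) \<and>
     (\<forall>(U, x)\<in>A. \<forall>bs\<in>lists Basis. length bs = r \<longrightarrow>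
        (\<forall>p\<in>U. smooth_near A p (\<lambda>q. \<phi> q (map (\<lambda>b. coord_vector A (U, x) b q) bs))))}"


section \<open>Connections and the symmetric derivative\<close>

definition connection ::
  "('a, 'e::euclidean_space) chart set \<Rightarrow> ('a field \<Rightarrow> 'a field \<Rightarrow> 'a field) \<Rightarrow> bool" where
  "connection A nabla \<longleftrightarrow>
     (\<forall>X\<in>vector_fields A. \<forall>Y\<in>vector_fields A. nabla X Y \<in> vector_fields A) \<and>
     (\<forall>X\<in>vector_fields A. \<forall>X'\<in>vector_fields A. \<forall>Y\<in>vector_fields A.
        nabla (field_add X X') Y = field_add (nabla X Y) (nabla X' Y)) \<and>
     (\<forall>h\<in>smooth_functions A. \<forall>X\<in>vector_fields A. \<forall>Y\<in>vector_fields A.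
        nabla (field_scale h X) Y = field_scale h (nabla X Y)) \<and>
     (\<forall>X\<in>vector_fields A. \<forall>Y\<in>vector_fields A. \<forall>Y'\<in>vector_fields A.
        nabla X (field_add Y Y') = field_add (nabla X Y) (nabla X Y')) \<and>
     (\<forall>h\<in>smooth_functions A. \<forall>X\<in>vector_fields A. \<forall>Y\<in>vector_fields A.
        nabla X (field_scale h Y) =
          field_add (field_scale (\<lambda>p. X p h) Y) (field_scale h (nabla X Y)))"

text \<open>The extension of a connection to covariant tensor fields: the function
  \<open>(\<nabla>\<^sub>X \<phi>)(X\<^sub>1, \<dots>, X\<^sub>r) = X (\<phi>(X\<^sub>1, \<dots>, X\<^sub>r)) - (\<Sum>j. \<phi>(X\<^sub>1, \<dots>, \<nabla>\<^sub>X X\<^sub>j, \<dots>, X\<^sub>r))\<close>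
  for vector fields \<open>X\<close> and \<open>Xs = [X\<^sub>1, \<dots>, X\<^sub>r]\<close>.\<close>

definition tensor_deriv ::
  "('a field \<Rightarrow> 'a field \<Rightarrow> 'a field) \<Rightarrow> 'a field \<Rightarrow> 'a tensor_field \<Rightarrow> 'a field list \<Rightarrow> 'a \<Rightarrow> real"
  where
  "tensor_deriv nabla X \<phi> Xs = (\<lambda>p.
     X p (\<lambda>q. \<phi> q (map (\<lambda>Y. Y q) Xs)) -
     (\<Sum>j<length Xs. \<phi> p ((map (\<lambda>Y. Y p) Xs)[j := nabla X (Xs ! j) p])))"

definition sym_deriv_on_fields ::
  "('a field \<Rightarrow> 'a field \<Rightarrow> 'a field) \<Rightarrow> 'a tensor_field \<Rightarrow> 'a field list \<Rightarrow> 'a \<Rightarrow> real" where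
  "sym_deriv_on_fields nabla \<phi> Xs = (\<lambda>p.
     \<Sum>j<length Xs. tensor_deriv nabla (Xs ! j) \<phi> (take j Xs @ drop (Suc j) Xs) p)"

text \<open>The value at \<open>p\<close> of the preceding expression only depends on the values of the
  vector fields at \<open>p\<close>, so the tensor at \<open>p\<close> is obtained by extending tangent vectors to arbitrary
  vector fields. For a \<open>0\<close>-tensor field \<open>f\<close> and a list \<open>[v]\<close>, this is \<open>v f = df(v)\<close>.\<close>

definition extend ::
  "('a, 'e::euclidean_space) chart set \<Rightarrow> 'a \<Rightarrow> 'a tangent \<Rightarrow> 'a field" where
  "extend A p v = (SOME X. X \<in> vector_fields A \<and> X p = v)"

definition sym_deriv ::
  "('a, 'e::euclidean_space) chart set \<Rightarrow> ('a field \<Rightarrow> 'a field \<Rightarrow> 'a field) \<Rightarrow>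
   'a tensor_field \<Rightarrow> 'a tensor_field" where
  "sym_deriv A nabla \<phi> = (\<lambda>p vs. sym_deriv_on_fields nabla \<phi> (map (extend A p) vs) p)"

definition tilde :: "nat \<Rightarrow> 'a tensor_field \<Rightarrow> 'a \<times> 'a tangent \<Rightarrow> real" where
  "tilde r \<phi> = (\<lambda>(p, v). \<phi> p (replicate r v) / fact r)"


section \<open>The geodesic spray\<close>

text \<open>The horizontal subspace at \<open>u = (p, v)\<close> consists of the vectors \<open>dY\<^sub>p(W\<^sub>p)\<close> for vector
  fields \<open>Y\<close>, regarded as sections of the tangent bundle, with \<open>Y\<^sub>p = v\<close> and \<open>(\<nabla>\<^sub>W Y)\<^sub>p = 0\<close>.
  In natural coordinates, such a vector has components \<open>W\<^sup>i\<close> and \<open>W\<^sup>i \<partial>\<^sub>i Y\<^sup>k\<close>, and the last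
  condition is \<open>W\<^sup>i \<partial>\<^sub>i Y\<^sup>k = - \<Gamma>\<^sup>k\<^sub>i\<^sub>j W\<^sup>i v\<^sup>j\<close>. So the horizontal lift of \<open>w\<close> to \<open>u\<close> has components
  \<open>w\<^sup>i\<close> and \<open>- \<Gamma>\<^sup>k\<^sub>i\<^sub>j w\<^sup>i v\<^sup>j\<close>, and the geodesic spray has components \<open>v\<^sup>i\<close> and \<open>- \<Gamma>\<^sup>k\<^sub>i\<^sub>j v\<^sup>i v\<^sup>j\<close>.\<close>

definition horizontal_space ::
  "('a, 'e::euclidean_space) chart set \<Rightarrow> ('a field \<Rightarrow> 'a field \<Rightarrow> 'a field) \<Rightarrow>
   'a \<times> 'a tangent \<Rightarrow> ('a \<times> 'a tangent) tangent set" where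
  "horizontal_space A nabla = (\<lambda>(p, v).
     {differential (tangent_atlas A) (\<lambda>q. (q, Y q)) p (W p) | Y W.
        Y \<in> vector_fields A \<and> W \<in> vector_fields A \<and> Y p = v \<and> nabla W Y p = (\<lambda>_. 0)})"

definition horizontal_lift ::
  "('a, 'e::euclidean_space) chart set \<Rightarrow> ('a field \<Rightarrow> 'a field \<Rightarrow> 'a field) \<Rightarrow>
   'a \<times> 'a tangent \<Rightarrow> 'a tangent \<Rightarrow> ('a \<times> 'a tangent) tangent" where
  "horizontal_lift A nabla u w =
     (THE \<xi>. \<xi> \<in> horizontal_space A nabla u \<and> differential A fst u \<xi> = w)"

definition geodesic_spray ::
  "('a, 'e::euclidean_space) chart set \<Rightarrow> ('a field \<Rightarrow> 'a field \<Rightarrow> 'a field) \<Rightarrow>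
   ('a \<times> 'a tangent) field" where
  "geodesic_spray A nabla = (\<lambda>(p, v). horizontal_lift A nabla (p, v) v)"

end

theory Submission
  imports Defs "HOL-Computational_Algebra.Polynomial"
begin

text \<open>
  Let \<open>F\<close> be the function \<open>tilde r \<phi>\<close> and let \<open>X\<close>, \<open>Y\<close> be vector fields with the value \<open>v\<close> at \<open>p\<close>, where
  \<open>(\<nabla>\<^sub>X Y)\<^sub>p = 0\<close>. The derivative of \<open>Y\<close>, as a section of the tangent bundle, then maps \<open>v\<close> to
  the horizontal lift of \<open>v\<close>, so the spray differentiates \<open>F\<close> to \<open>v(F \<circ> Y)\<close>. The symmetric derivative is
  evaluated with the extension \<open>X\<close> of \<open>v\<close> in all of the slots, so its function on the tangent bundle is
  \<open>v(F \<circ> X) - (\<Sum>j. \<phi>(v, \<dots>, \<nabla>\<^sub>X X, \<dots>, v)) / r!\<close>. Both sides are thus compared by one formula, valid for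
  every smooth function \<open>F\<close> on the tangent bundle (\<open>section_derivative_diff\<close>):
  with \<open>z = (\<nabla>\<^sub>W X)\<^sub>p - (\<nabla>\<^sub>W Y)\<^sub>p\<close>,
  the derivative at \<open>0\<close> of \<open>t \<mapsto> F(p, v + t z)\<close> is \<open>W\<^sub>p(F \<circ> X) - W\<^sub>p(F \<circ> Y)\<close>. It holds because the images
  of \<open>W\<^sub>p\<close> under the derivatives of the two sections have the same horizontal coordinates and because
  the difference of their vertical coordinates is \<open>W\<^sub>p(X\<^sup>k) - W\<^sub>p(Y\<^sup>k) = z\<^sup>k\<close>.

  For \<open>z = 0\<close>, this formula also says that horizontal lifts are unique (\<open>horizontal_lift_eq\<close>). They
  exist since \<open>Y = X + h \<nabla>\<^sub>X X\<close> is parallel along \<open>v\<close> at \<open>p\<close> if \<open>h\<close> vanishes at \<open>p\<close> and \<open>v h = -1\<close>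
  (\<open>horizontal_section_exists\<close>). For \<open>F = tilde r \<phi>\<close>, the derivative along the line in the fibre
  follows from multilinearity (\<open>sym_tensor_line_derivative\<close>), and it is the sum over \<open>j\<close> above.

  The remaining work is foundational. A derivation is determined by its values on the coordinates
  by Hadamard's lemma (\<open>tangent_expansion\<close>). A bump function cuts the local expansion
  of a vector field off to a global one, so the axioms of a connection determine how \<open>\<nabla>\<^sub>X Y\<close>
  depends on \<open>X\<close> and \<open>Y\<close> at a point (\<open>nabla_left_zero_at\<close>, \<open>nabla_right_zero_at\<close>).
\<close>

section \<open>Calculus of smooth functions\<close>

lemma frechet_derivative_eqI: "(f has_derivative f') (at x) \<Longrightarrow> frechet_derivative f (at x) = f'"
  by (rule frechet_derivative_at[symmetric])

lemma frechet_derivative_cong_open: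
  assumes "open S" "x \<in> S" "\<And>y. y \<in> S \<Longrightarrow> f y = g y"
  shows "frechet_derivative f (at x) = frechet_derivative g (at x)"
proof -
  have "(f has_derivative D) (at x) \<longleftrightarrow> (g has_derivative D) (at x)" for D
    using assms has_derivative_transform_within_open[of f D x UNIV S g]
      has_derivative_transform_within_open[of g D x UNIV S f] by auto
  then show ?thesis unfolding frechet_derivative_def by simp
qed

lemma differentiable_cong_open:
  assumes "open S" "x \<in> S" "\<And>y. y \<in> S \<Longrightarrow> f y = g y" "f differentiable (at x)"
  shows "g differentiable (at x)"
  using assms has_derivative_transform_within_open[of f _ x UNIV S g]
  unfolding differentiable_def by blast

lemma Ck_on_cong:
  "open S \<Longrightarrow> (\<And>x. x \<in> S \<Longrightarrow> f x = g x) \<Longrightarrow> Ck_on k S f \<Longrightarrow> Ck_on k S g"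
proof (induction k arbitrary: f g)
  case 0
  then show ?case using continuous_on_cong[of S S f g] by simp
next
  case (Suc k)
  have 1: "frechet_derivative f (at x) b = frechet_derivative g (at x) b" if "x \<in> S" for x b
    using frechet_derivative_cong_open[OF Suc.prems(1) that Suc.prems(2)] by simp
  have "Ck_on k S (\<lambda>x. frechet_derivative g (at x) b)" if "b \<in> Basis" for b
    using Suc.IH[OF Suc.prems(1) 1] Suc.prems(3) that by auto
  moreover have "\<forall>x\<in>S. g differentiable (at x)"
    using differentiable_cong_open[OF Suc.prems(1) _ Suc.prems(2)] Suc.prems(3) by auto
  ultimately show ?case by simp
qed

lemma Ck_on_subset: "Ck_on k S f \<Longrightarrow> R \<subseteq> S \<Longrightarrow> Ck_on k R f"
  by (induction k arbitrary: f) (auto intro: continuous_on_subset)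

lemma Ck_on_Suc_imp_Ck_on: "Ck_on (Suc k) S f \<Longrightarrow> Ck_on k S f"
proof (induction k arbitrary: f)
  case 0
  then show ?case
    by (auto intro!: continuous_at_imp_continuous_on differentiable_imp_continuous_within)
next
  case (Suc k)
  from Suc.prems have "\<forall>b\<in>Basis. Ck_on (Suc k) S (\<lambda>x. frechet_derivative f (at x) b)"
    and "\<forall>x\<in>S. f differentiable (at x)" by auto
  then show ?case using Suc.IH by (simp only: Ck_on.simps(2)[of k]) blast
qed

text \<open>The closure properties of \<^const>\<open>Ck_on\<close> are proved by induction on the order, and each
  step only has to compute one partial derivative on the set.\<close>

lemma Ck_on_SucI:
  assumes "open S" "\<And>x. x \<in> S \<Longrightarrow> (f has_derivative D x) (at x)"
    and "\<And>b. b \<in> Basis \<Longrightarrow> Ck_on k S (\<lambda>x. D x b)"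
  shows "Ck_on (Suc k) S f"
proof -
  have "Ck_on k S (\<lambda>x. frechet_derivative f (at x) b)" if "b \<in> Basis" for b
    by (rule Ck_on_cong[OF assms(1) _ assms(3)[OF that]])
      (simp add: frechet_derivative_eqI[OF assms(2)])
  then show ?thesis using assms(2) by (auto simp: differentiable_def)
qed

lemma Ck_on_Suc_has_derivative:
  "Ck_on (Suc k) S f \<Longrightarrow> x \<in> S \<Longrightarrow> (f has_derivative frechet_derivative f (at x)) (at x)"
  by (simp add: frechet_derivative_works)

lemma Ck_on_const: "open S \<Longrightarrow> Ck_on k S (\<lambda>_. c)"
proof (induction k arbitrary: c)
  case (Suc k)
  show ?case by (rule Ck_on_SucI[where D="\<lambda>_ _. 0"]) (auto simp: Suc)
qed simp

lemma Ck_on_add: "open S \<Longrightarrow> Ck_on k S f \<Longrightarrow> Ck_on k S g \<Longrightarrow> Ck_on k S (\<lambda>x. f x + g x)"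
proof (induction k arbitrary: f g)
  case (Suc k)
  show ?case
  proof (rule Ck_on_SucI[OF Suc.prems(1)])
    show "((\<lambda>x. f x + g x) has_derivative
        (\<lambda>b. frechet_derivative f (at x) b + frechet_derivative g (at x) b)) (at x)"
      if "x \<in> S" for x
      using Suc.prems that by (intro has_derivative_add Ck_on_Suc_has_derivative)
    show "Ck_on k S (\<lambda>x. frechet_derivative f (at x) b + frechet_derivative g (at x) b)"
      if "b \<in> Basis" for b
      using Suc that by auto
  qed
qed (auto intro: continuous_on_add)

lemma Ck_on_bounded_linear:
  "bounded_linear L \<Longrightarrow> open S \<Longrightarrow> Ck_on k S f \<Longrightarrow> Ck_on k S (\<lambda>x. L (f x))"
proof (induction k arbitrary: f)
  case 0
  then show ?case by (auto intro: bounded_linear.continuous_on)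
next
  case (Suc k)
  show ?case
  proof (rule Ck_on_SucI[OF Suc.prems(2)])
    show "((\<lambda>x. L (f x)) has_derivative (\<lambda>b. L (frechet_derivative f (at x) b))) (at x)"
      if "x \<in> S" for x
      using Suc.prems that
      by (intro bounded_linear.has_derivative[OF Suc.prems(1)] Ck_on_Suc_has_derivative)
    show "Ck_on k S (\<lambda>x. L (frechet_derivative f (at x) b))" if "b \<in> Basis" for b
      using Suc that by auto
  qed
qed

lemma Ck_on_scaleR:
  fixes f :: "'e::euclidean_space \<Rightarrow> real"
  shows "open S \<Longrightarrow> Ck_on k S f \<Longrightarrow> Ck_on k S g \<Longrightarrow> Ck_on k S (\<lambda>x. f x *\<^sub>R g x)"
proof (induction k arbitrary: f g)
  case (Suc k)
  show ?case
  proof (rule Ck_on_SucI[OF Suc.prems(1)])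
    show "((\<lambda>x. f x *\<^sub>R g x) has_derivative
        (\<lambda>b. f x *\<^sub>R frechet_derivative g (at x) b + frechet_derivative f (at x) b *\<^sub>R g x)) (at x)"
      if "x \<in> S" for x
      using Suc.prems that by (intro has_derivative_scaleR Ck_on_Suc_has_derivative)
    show "Ck_on k S (\<lambda>x. f x *\<^sub>R frechet_derivative g (at x) b +
        frechet_derivative f (at x) b *\<^sub>R g x)" if "b \<in> Basis" for b
      using Suc.prems that Suc.prems(2,3)[THEN Ck_on_Suc_imp_Ck_on]
      by (intro Ck_on_add Suc.IH) auto
  qed
qed (auto intro: continuous_on_scaleR)

lemma Ck_on_sum:
  assumes "open S" "\<And>i. i \<in> I \<Longrightarrow> Ck_on k S (f i)"
  shows "Ck_on k S (\<lambda>x. \<Sum>i\<in>I. f i x)"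
proof (cases "finite I")
  case True
  then show ?thesis using assms(2)
    by (induction I) (auto intro: Ck_on_add Ck_on_const assms(1))
qed (simp add: Ck_on_const assms(1))

lemma bounded_linear_sum_Basis:
  fixes L :: "'e::euclidean_space \<Rightarrow> 'f::real_normed_vector"
  assumes "bounded_linear L"
  shows "L w = (\<Sum>b\<in>Basis. (w \<bullet> b) *\<^sub>R L b)"
proof -
  interpret bounded_linear L by fact
  have "L w = L (\<Sum>b\<in>Basis. (w \<bullet> b) *\<^sub>R b)" by (simp add: euclidean_representation)
  then show ?thesis by (simp add: sum scaleR)
qed

lemma Ck_on_compose:
  fixes f :: "'e::euclidean_space \<Rightarrow> 'f::euclidean_space"
  shows "open S \<Longrightarrow> open R \<Longrightarrow> f ` S \<subseteq> R \<Longrightarrow> Ck_on k S f \<Longrightarrow> Ck_on k R g \<Longrightarrow>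
    Ck_on k S (\<lambda>x. g (f x))"
proof (induction k arbitrary: g)
  case 0
  then show ?case using continuous_on_compose2 by auto
next
  case (Suc k)
  show ?case
  proof (rule Ck_on_SucI[OF Suc.prems(1)])
    show "((\<lambda>x. g (f x)) has_derivative (\<lambda>b. \<Sum>c\<in>Basis.
        (frechet_derivative f (at x) b \<bullet> c) *\<^sub>R frechet_derivative g (at (f x)) c)) (at x)"
      if "x \<in> S" for x
    proof -
      have g: "(g has_derivative frechet_derivative g (at (f x))) (at (f x))"
        using Suc.prems that by (intro Ck_on_Suc_has_derivative) auto
      have "((\<lambda>x. g (f x)) has_derivative
          (\<lambda>b. frechet_derivative g (at (f x)) (frechet_derivative f (at x) b))) (at x)"
        using has_derivative_compose[OF Ck_on_Suc_has_derivative[OF Suc.prems(4) that] g] .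
      then show ?thesis
        by (subst (asm) bounded_linear_sum_Basis[OF has_derivative_bounded_linear[OF g]])
    qed
    show "Ck_on k S (\<lambda>x. \<Sum>c\<in>Basis.
        (frechet_derivative f (at x) b \<bullet> c) *\<^sub>R frechet_derivative g (at (f x)) c)"
      if "b \<in> Basis" for b
      using Suc.prems that Ck_on_Suc_imp_Ck_on[OF Suc.prems(4)]
      by (intro Ck_on_sum Ck_on_scaleR Suc.IH Ck_on_bounded_linear[OF bounded_linear_inner_left]) auto
  qed
qed

lemma Ck_on_Union:
  "(\<And>S. S \<in> \<S> \<Longrightarrow> open S) \<Longrightarrow> (\<And>S. S \<in> \<S> \<Longrightarrow> Ck_on k S f) \<Longrightarrow> Ck_on k (\<Union>\<S>) f"
proof (induction k arbitrary: f)
  case 0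
  then show ?case by (auto intro: continuous_on_open_Union)
next
  case (Suc k)
  then show ?case by simp
qed

lemma smooth_on_Ck_on: "smooth_on S f \<Longrightarrow> Ck_on k S f"
  and smooth_on_open: "smooth_on S f \<Longrightarrow> open S"
  by (auto simp: smooth_on_def)

lemma smooth_on_cong: "smooth_on S f \<Longrightarrow> (\<And>x. x \<in> S \<Longrightarrow> f x = g x) \<Longrightarrow> smooth_on S g"
  unfolding smooth_on_def using Ck_on_cong[of S f g] by blast

lemma smooth_on_subset: "smooth_on S f \<Longrightarrow> open R \<Longrightarrow> R \<subseteq> S \<Longrightarrow> smooth_on R f"
  unfolding smooth_on_def using Ck_on_subset by blast

lemma smooth_on_const: "open S \<Longrightarrow> smooth_on S (\<lambda>_. c)"
  by (simp add: smooth_on_def Ck_on_const)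

lemma smooth_on_add: "smooth_on S f \<Longrightarrow> smooth_on S g \<Longrightarrow> smooth_on S (\<lambda>x. f x + g x)"
  by (simp add: smooth_on_def Ck_on_add)

lemma smooth_on_bounded_linear: "bounded_linear L \<Longrightarrow> smooth_on S f \<Longrightarrow> smooth_on S (\<lambda>x. L (f x))"
  by (simp add: smooth_on_def Ck_on_bounded_linear)

lemma smooth_on_scaleR:
  fixes f :: "'e::euclidean_space \<Rightarrow> real"
  shows "smooth_on S f \<Longrightarrow> smooth_on S g \<Longrightarrow> smooth_on S (\<lambda>x. f x *\<^sub>R g x)"
  by (simp add: smooth_on_def Ck_on_scaleR)

lemma smooth_on_mult:
  fixes f :: "'e::euclidean_space \<Rightarrow> real"
  shows "smooth_on S f \<Longrightarrow> smooth_on S g \<Longrightarrow> smooth_on S (\<lambda>x. f x * g x)"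
  using smooth_on_scaleR[of S f g] by simp

lemma smooth_on_sum:
  "open S \<Longrightarrow> (\<And>i. i \<in> I \<Longrightarrow> smooth_on S (f i)) \<Longrightarrow> smooth_on S (\<lambda>x. \<Sum>i\<in>I. f i x)"
  by (simp add: smooth_on_def Ck_on_sum)

lemma smooth_on_compose:
  fixes f :: "'e::euclidean_space \<Rightarrow> 'f::euclidean_space"
  shows "smooth_on R g \<Longrightarrow> smooth_on S f \<Longrightarrow> f ` S \<subseteq> R \<Longrightarrow> smooth_on S (\<lambda>x. g (f x))"
  unfolding smooth_on_def using Ck_on_compose[of S R f _ g] by blast

lemma smooth_on_Union:
  "(\<And>S. S \<in> \<S> \<Longrightarrow> smooth_on S f) \<Longrightarrow> smooth_on (\<Union>\<S>) f"
  by (simp add: smooth_on_def Ck_on_Union open_Union)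

lemma smooth_on_has_derivative:
  "smooth_on S f \<Longrightarrow> x \<in> S \<Longrightarrow> (f has_derivative frechet_derivative f (at x)) (at x)"
  using Ck_on_Suc_has_derivative[of 0 S f x] smooth_on_Ck_on[of S f] by blast

lemma smooth_on_partial_derivative:
  "smooth_on S f \<Longrightarrow> b \<in> Basis \<Longrightarrow> smooth_on S (\<lambda>x. frechet_derivative f (at x) b)"
  unfolding smooth_on_def using Ck_on.simps(2)[of _ S f] by blast

lemma smooth_on_imp_continuous_on: "smooth_on S f \<Longrightarrow> continuous_on S f"
  using smooth_on_Ck_on[where k=0] by simp

lemma smooth_on_id: "open S \<Longrightarrow> smooth_on S (\<lambda>x. x)"
proof -
  assume S: "open S"
  have "Ck_on k S (\<lambda>x. x)" for k
    by (cases k) (auto intro!: Ck_on_SucI[where D="\<lambda>_ b. b"] Ck_on_const S)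
  then show ?thesis using S by (simp add: smooth_on_def)
qed

section \<open>A smooth bump function\<close>

text \<open>For \<open>P = 1\<close>, this is the classical smooth function \<open>exp(-1/t)\<close>. The polynomial makes the family closed
  under differentiation.\<close>

definition flat :: "real poly \<Rightarrow> real \<Rightarrow> real" where
  "flat P t = (if t > 0 then poly P (1 / t) * exp (- (1 / t)) else 0)"

lemma poly_exp_tendsto_0: "((\<lambda>s. poly P s * exp (- s)) \<longlongrightarrow> (0::real)) at_top"
proof -
  have "((\<lambda>s. \<Sum>i\<le>degree P. coeff P i * (s ^ i / exp s)) \<longlongrightarrow> (\<Sum>i\<le>degree P. coeff P i * 0)) at_top"
    by (intro tendsto_sum tendsto_mult tendsto_const tendsto_power_div_exp_0)
  then show ?thesis
    by (simp add: poly_altdef exp_minus sum_distrib_right divide_inverse mult.assoc)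
qed

text \<open>At \<open>t > 0\<close>, the chain rule in \<open>s = 1 / t\<close> turns \<open>P\<close> into \<open>(P - P') s\<^sup>2\<close>. At \<open>0\<close>, the difference
  quotient is \<open>s P(s) exp(-s)\<close> from the right, and the exponential beats the polynomial.\<close>

lemma flat_has_derivative:
  "(flat P has_real_derivative flat ((P - pderiv P) * [:0, 0, 1:]) t) (at t)"
proof -
  consider "t > 0" | "t < 0" | "t = 0" by linarith
  then show ?thesis
  proof cases
    case 1
    have "((\<lambda>t. poly P (1 / t) * exp (- (1 / t))) has_real_derivative
        flat ((P - pderiv P) * [:0, 0, 1:]) t) (at t)"
      using 1 by (auto intro!: derivative_eq_intros DERIV_chain'[where g="poly P"] poly_DERIV
         simp: flat_def algebra_simps power2_eq_square)
    moreover have "\<forall>\<^sub>F s in nhds t. flat P s = poly P (1 / s) * exp (- (1 / s))"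
      using 1 by (auto simp: flat_def eventually_nhds intro!: exI[of _ "{0<..}"])
    ultimately show ?thesis by (subst DERIV_cong_ev[OF refl _ refl])
  next
    case 2
    have "((\<lambda>t. 0) has_real_derivative flat ((P - pderiv P) * [:0, 0, 1:]) t) (at t)"
      using 2 by (auto simp: flat_def)
    moreover have "\<forall>\<^sub>F s in nhds t. flat P s = 0"
      using 2 by (auto simp: flat_def eventually_nhds intro!: exI[of _ "{..<0}"])
    ultimately show ?thesis by (subst DERIV_cong_ev[OF refl _ refl])
  next
    case 3
    have "((\<lambda>h. flat P h / h) \<longlongrightarrow> 0) (at 0)"
    proof (rule filterlim_split_at)
      show "((\<lambda>h. flat P h / h) \<longlongrightarrow> 0) (at_left 0)"
        by (rule tendsto_eventually) (auto simp: flat_def eventually_at_filter)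
      have "((\<lambda>h. poly (pCons 0 P) (inverse h) * exp (- (inverse h))) \<longlongrightarrow> 0) (at_right 0)"
        by (rule filterlim_compose[OF poly_exp_tendsto_0 filterlim_inverse_at_top_right])
      moreover have "\<forall>\<^sub>F h in at_right 0.
          poly (pCons 0 P) (inverse h) * exp (- (inverse h)) = flat P h / h"
        by (auto simp: flat_def eventually_at_filter field_simps)
      ultimately show "((\<lambda>h. flat P h / h) \<longlongrightarrow> 0) (at_right 0)"
        by (rule Lim_transform_eventually)
    qed
    then show ?thesis using 3 by (simp add: DERIV_def flat_def)
  qed
qed

lemma smooth_on_flat: "smooth_on UNIV (flat P)"
proof -
  have "Ck_on k UNIV (flat P)" for k
  proof (induction k arbitrary: P)
    case 0
    then show ?case using flat_has_derivative[THEN DERIV_isCont]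
      by (auto intro: continuous_at_imp_continuous_on)
  next
    case (Suc k)
    show ?case
    proof (rule Ck_on_SucI)
      show "(flat P has_derivative (\<lambda>h. flat ((P - pderiv P) * [:0, 0, 1:]) t * h)) (at t)" for t
        using flat_has_derivative has_field_derivative_def by blast
    qed (use Suc in \<open>auto simp: Basis_real_def\<close>)
  qed
  then show ?thesis by (simp add: smooth_on_def)
qed

text \<open>The function is \<open>exp(-1/t)\<close> at \<open>t = e\<^sup>2 - |y - a|\<^sup>2\<close>, normalized to \<open>1\<close> at the centre. It is not
  constant near the centre: the value \<open>1\<close> at one point suffices, because cut-off functions are only
  used to evaluate identities at that point.\<close>

lemma smooth_bump:
  fixes a :: "'e::euclidean_space"
  assumes "e > 0"
  obtains \<beta> :: "'e \<Rightarrow> real" where "smooth_on UNIV \<beta>" "\<beta> a = 1" "\<And>y. y \<notin> cball a e \<Longrightarrow> \<beta> y = 0"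
proof
  let ?q = "\<lambda>y. e\<^sup>2 - (\<Sum>b\<in>Basis. ((y - a) \<bullet> b) * ((y - a) \<bullet> b))"
  let ?\<beta> = "\<lambda>y. (1 / flat 1 (e\<^sup>2)) * flat 1 (?q y)"
  have lin: "smooth_on UNIV (\<lambda>y. (y - a) \<bullet> b)" for b
  proof -
    have "smooth_on UNIV (\<lambda>y. (y \<bullet> b) + (- (a \<bullet> b)))"
      by (intro smooth_on_add smooth_on_const smooth_on_bounded_linear[OF bounded_linear_inner_left]
        smooth_on_id) auto
    then show ?thesis by (simp add: inner_diff_left)
  qed
  have "smooth_on UNIV (\<lambda>y. e\<^sup>2 + - 1 * (\<Sum>b\<in>Basis. ((y - a) \<bullet> b) * ((y - a) \<bullet> b)))"
    by (intro smooth_on_add smooth_on_const smooth_on_mult smooth_on_sum lin) auto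
  then have q: "smooth_on UNIV ?q" by simp
  show "smooth_on UNIV ?\<beta>"
    by (intro smooth_on_mult smooth_on_const smooth_on_compose[OF smooth_on_flat q]) auto
  show "?\<beta> a = 1" using assms by (simp add: flat_def)
  show "?\<beta> y = 0" if "y \<notin> cball a e" for y
  proof -
    have "e\<^sup>2 < (norm (y - a))\<^sup>2"
      using that assms by (intro power_strict_mono) (auto simp: dist_norm norm_minus_commute)
    then have "?q y < 0" by (simp add: power2_norm_eq_inner euclidean_inner[of "y - a" "y - a"])
    then show ?thesis by (simp add: flat_def)
  qed
qed

section \<open>Hadamard's lemma\<close>

lemma ball_segment_mem:
  fixes a :: "'e::euclidean_space"
  assumes "x \<in> ball a e" "t \<in> {0..1}"
  shows "a + t *\<^sub>R (x - a) \<in> ball a e"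
proof -
  have "a \<in> ball a e" using assms(1) by (metis ball_eq_empty centre_in_ball empty_iff not_le)
  then have "(1 - t) *\<^sub>R a + t *\<^sub>R x \<in> ball a e"
    using assms convexD[OF convex_ball, of a a e x "1 - t" t] by auto
  then show ?thesis by (simp add: algebra_simps)
qed

lemma continuous_on_segment_weight:
  fixes f :: "'e::euclidean_space \<Rightarrow> real"
  assumes "continuous_on (ball a e) f"
  shows "continuous_on (ball a e \<times> {0..1}) (\<lambda>(x, t). t ^ m * f (a + t *\<^sub>R (x - a)))"
proof -
  have "continuous_on (ball a e \<times> {0..1}) (\<lambda>z. f (a + snd z *\<^sub>R (fst z - a)))"
    by (rule continuous_on_compose2[OF assms])
      (use ball_segment_mem[of _ a e] in \<open>force intro!: continuous_intros\<close>)+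
  then show ?thesis unfolding case_prod_beta by (intro continuous_intros)
qed

lemma continuous_on_segment_slice:
  fixes f :: "'e::euclidean_space \<Rightarrow> real"
  assumes "continuous_on (ball a e) f" "x \<in> ball a e"
  shows "continuous_on {0..1} (\<lambda>t. t ^ m * f (a + t *\<^sub>R (x - a)))"
proof -
  have "continuous_on {0..1} (\<lambda>t. case (x, t) of (x, t) \<Rightarrow> t ^ m * f (a + t *\<^sub>R (x - a)))"
    by (rule continuous_on_compose2[OF continuous_on_segment_weight[OF assms(1)]])
      (use assms(2) in \<open>auto intro!: continuous_intros\<close>)
  then show ?thesis by simp
qed

text \<open>A partial derivative of the integral is an integral of the same kind, with one more factor \<open>t\<close>
  from the chain rule. The power \<open>m\<close> is there to let the induction go through.\<close>

lemma Ck_on_segment_integral: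
  fixes f :: "'e::euclidean_space \<Rightarrow> real"
  shows "Ck_on k (ball a e) f \<Longrightarrow>
    Ck_on k (ball a e) (\<lambda>x. integral {0..1} (\<lambda>t. t ^ m * f (a + t *\<^sub>R (x - a))))"
proof (induction k arbitrary: f m)
  case 0
  then show ?case
    using integral_continuous_on_param[where a="0::real" and b=1, unfolded cbox_interval,
        OF continuous_on_segment_weight] by auto
next
  case (Suc k)
  let ?B = "ball a e"
  let ?d = "\<lambda>b x t. t ^ Suc m * frechet_derivative f (at (a + t *\<^sub>R (x - a))) b"
  have f0: "Ck_on 0 ?B f"
    using Suc.prems
    by (auto intro!: continuous_at_imp_continuous_on differentiable_imp_continuous_within)
  have d0: "continuous_on ?B (\<lambda>x. frechet_derivative f (at x) b)" if "b \<in> Basis" for b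
  proof -
    have *: "Ck_on k S g \<Longrightarrow> continuous_on S g" for S and g :: "'e \<Rightarrow> real"
      by (cases k) (auto intro!: continuous_at_imp_continuous_on differentiable_imp_continuous_within)
    show ?thesis using Suc.prems that by (auto intro: *)
  qed
  show ?case
  proof (rule Ck_on_SucI)
    fix x assume x: "x \<in> ?B"
    let ?D = "\<lambda>x t. \<Sum>b\<in>Basis. ?d b x t *\<^sub>R blinfun_inner_left b"
    have "((\<lambda>x. integral (cbox 0 1) (\<lambda>t. t ^ m * f (a + t *\<^sub>R (x - a)))) has_derivative
        blinfun_apply (integral (cbox 0 1) (?D x))) (at x within ?B)"
    proof (rule leibniz_rule[OF _ _ _ x convex_ball])
      fix y t assume y: "y \<in> ?B" and t: "t \<in> cbox 0 (1::real)"
      have mem: "a + t *\<^sub>R (y - a) \<in> ?B" using ball_segment_mem y t by (simp add: mem_ball)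
      note f = Ck_on_Suc_has_derivative[OF Suc.prems mem]
      have inner: "((\<lambda>y. a + t *\<^sub>R (y - a)) has_derivative (\<lambda>h. t *\<^sub>R h)) (at y)"
        by (auto intro!: derivative_eq_intros)
      have "((\<lambda>y. t ^ m * f (a + t *\<^sub>R (y - a))) has_derivative
          (\<lambda>h. t ^ m * frechet_derivative f (at (a + t *\<^sub>R (y - a))) (t *\<^sub>R h))) (at y)"
        by (intro has_derivative_mult_right has_derivative_compose[OF inner f])
      also have "(\<lambda>h. t ^ m * frechet_derivative f (at (a + t *\<^sub>R (y - a))) (t *\<^sub>R h)) =
          blinfun_apply (?D y t)"
        by (rule ext, subst bounded_linear_sum_Basis[OF has_derivative_bounded_linear[OF f]])
          (simp add: blinfun.sum_left blinfun.scaleR_left sum_distrib_left algebra_simps)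
      finally show "((\<lambda>y. t ^ m * f (a + t *\<^sub>R (y - a))) has_derivative blinfun_apply (?D y t))
          (at y within ?B)" by (rule has_derivative_at_withinI)
    next
      fix y assume "y \<in> ?B"
      then show "(\<lambda>t. t ^ m * f (a + t *\<^sub>R (y - a))) integrable_on cbox 0 1"
        unfolding cbox_interval using f0
        by (intro integrable_continuous_interval continuous_on_segment_slice) auto
    next
      have *: "continuous_on (?B \<times> {0..1}) (\<lambda>z. ?d b (fst z) (snd z))" if "b \<in> Basis" for b
        using continuous_on_segment_weight[OF d0[OF that], of "Suc m"]
        by (simp add: case_prod_beta)
      show "continuous_on (?B \<times> cbox 0 1) (\<lambda>(x, t). ?D x t)"
        unfolding case_prod_beta cbox_interval
        by (rule continuous_on_sum, rule continuous_on_scaleR[OF * continuous_on_const])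
    qed
    moreover have "integral (cbox 0 1) (?D x) =
        (\<Sum>b\<in>Basis. integral {0..1} (?d b x) *\<^sub>R blinfun_inner_left b)"
      unfolding cbox_interval
      by (rule integral_unique, rule has_integral_sum[OF finite_Basis],
          rule has_integral_scaleR_left, rule integrable_integral,
          rule integrable_continuous_interval, rule continuous_on_segment_slice[OF d0 x])
    moreover have "blinfun_apply (\<Sum>b\<in>Basis. integral {0..1} (?d b x) *\<^sub>R blinfun_inner_left b) =
        (\<lambda>h. \<Sum>b\<in>Basis. integral {0..1} (?d b x) * (h \<bullet> b))"
      by (rule ext) (simp add: blinfun.sum_left blinfun.scaleR_left)
    ultimately show "((\<lambda>x. integral {0..1} (\<lambda>t. t ^ m * f (a + t *\<^sub>R (x - a)))) has_derivative
        (\<lambda>h. \<Sum>b\<in>Basis. integral {0..1} (?d b x) * (h \<bullet> b))) (at x)"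
      by (simp only: at_within_open[OF x open_ball] cbox_interval)
  next
    fix b :: 'e assume b: "b \<in> Basis"
    have "Ck_on k ?B (\<lambda>x. integral {0..1} (?d b x))"
      using Suc.IH[of "\<lambda>x. frechet_derivative f (at x) b" "Suc m"] Suc.prems b by auto
    moreover have "(\<Sum>c\<in>Basis. integral {0..1} (?d c x) * (b \<bullet> c)) = integral {0..1} (?d b x)" for x
      using b by (simp add: inner_Basis if_distrib sum.delta cong: if_cong)
    ultimately show "Ck_on k ?B (\<lambda>x. \<Sum>c\<in>Basis. integral {0..1} (?d c x) * (b \<bullet> c))"
      by simp
  qed simp
qed

text \<open>The coefficients are \<open>\<integral>\<^sub>0\<^sup>1 \<partial>\<^sub>b f (a + t (x - a)) dt\<close>, by integrating the derivative of \<open>f\<close> along the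
  segment from \<open>a\<close> to \<open>x\<close>.\<close>

lemma Hadamard:
  fixes f :: "'e::euclidean_space \<Rightarrow> real"
  assumes f: "smooth_on (ball a e) f" and "e > 0"
  obtains g where "\<And>b. b \<in> Basis \<Longrightarrow> smooth_on (ball a e) (g b)"
    and "\<And>b. b \<in> Basis \<Longrightarrow> g b a = frechet_derivative f (at a) b"
    and "\<And>x. x \<in> ball a e \<Longrightarrow> f x = f a + (\<Sum>b\<in>Basis. ((x - a) \<bullet> b) * g b x)"
proof
  let ?g = "\<lambda>b x. integral {0..1} (\<lambda>t. t ^ 0 * frechet_derivative f (at (a + t *\<^sub>R (x - a))) b)"
  show "smooth_on (ball a e) (?g b)" if "b \<in> Basis" for b
    using smooth_on_partial_derivative[OF f that] Ck_on_segment_integral unfolding smooth_on_def by blast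
  show "?g b a = frechet_derivative f (at a) b" for b by simp
  fix x assume x: "x \<in> ball a e"
  have d: "(f has_derivative frechet_derivative f (at (a + t *\<^sub>R (x - a)))) (at (a + t *\<^sub>R (x - a)))"
    if "t \<in> {0..1}" for t
    using smooth_on_has_derivative[OF f ball_segment_mem[OF x that]] .
  have "((\<lambda>t. frechet_derivative f (at (a + t *\<^sub>R (x - a))) (x - a)) has_integral
      f (a + 1 *\<^sub>R (x - a)) - f (a + 0 *\<^sub>R (x - a))) {0..1}"
  proof (rule fundamental_theorem_of_calculus)
    fix t :: real assume t: "t \<in> {0..1}"
    have inner: "((\<lambda>t. a + t *\<^sub>R (x - a)) has_derivative (\<lambda>h. h *\<^sub>R (x - a))) (at t within {0..1})"
      by (auto intro!: derivative_eq_intros)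
    show "((\<lambda>t. f (a + t *\<^sub>R (x - a))) has_vector_derivative
        frechet_derivative f (at (a + t *\<^sub>R (x - a))) (x - a)) (at t within {0..1})"
      unfolding has_vector_derivative_def
      using has_derivative_compose[OF inner d[OF t]]
      by (simp add: linear_cmul[OF has_derivative_linear[OF d[OF t]]])
  qed simp
  then have "f x - f a = integral {0..1} (\<lambda>t. frechet_derivative f (at (a + t *\<^sub>R (x - a))) (x - a))"
    by (simp add: integral_unique)
  also have "\<dots> = integral {0..1} (\<lambda>t. \<Sum>b\<in>Basis.
      ((x - a) \<bullet> b) * (t ^ 0 * frechet_derivative f (at (a + t *\<^sub>R (x - a))) b))"
    by (intro integral_cong) (subst bounded_linear_sum_Basis[OF has_derivative_bounded_linear[OF d]], auto)
  also have "\<dots> = (\<Sum>b\<in>Basis. ((x - a) \<bullet> b) * ?g b x)"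
  proof (intro integral_unique has_integral_sum has_integral_mult_right integrable_integral
      integrable_continuous_interval)
    fix b :: 'e assume "b \<in> Basis"
    then have "continuous_on (ball a e) (\<lambda>x. frechet_derivative f (at x) b)"
      by (intro smooth_on_imp_continuous_on smooth_on_partial_derivative f)
    then show "continuous_on {0..1} (\<lambda>t. t ^ 0 * frechet_derivative f (at (a + t *\<^sub>R (x - a))) b)"
      by (rule continuous_on_segment_slice[OF _ x])
  qed simp
  finally show "f x = f a + (\<Sum>b\<in>Basis. ((x - a) \<bullet> b) * ?g b x)" by simp
qed

section \<open>Smooth functions and derivations on a manifold\<close>

context smooth_manifold
begin

lemma points_eq_topspace: "points A = topspace T"
  using charts_cover by (simp add: points_def)

lemma chart_points: "(U, x) \<in> A \<Longrightarrow> p \<in> U \<Longrightarrow> p \<in> points A"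
  by (auto simp: points_def)

lemma chart_at:
  assumes "p \<in> points A"
  obtains U x where "(U, x) \<in> A" "p \<in> U"
  using assms by (auto simp: points_def)

lemma topspace_chart: "(U, x) \<in> A \<Longrightarrow> topspace (subtopology T U) = U"
  using chart_domain openin_subset by (metis inf.absorb_iff2 topspace_subtopology)

lemma chart_inj: "(U, x) \<in> A \<Longrightarrow> inj_on x U"
  using homeomorphic_imp_injective_map[OF chart_homeomorphic] topspace_chart by metis

lemma chart_inv [simp]: "(U, x) \<in> A \<Longrightarrow> p \<in> U \<Longrightarrow> inv_into U x (x p) = p"
  using chart_inj by simp

lemma chart_open_preimage:
  assumes "(U, x) \<in> A" "open W"
  shows "openin T {q\<in>U. x q \<in> W}"
proof -
  have "openin (top_of_set (x ` U)) (x ` U \<inter> W)" using assms(2) by (simp add: openin_open_Int)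
  from openin_continuous_map_preimage[OF homeomorphic_imp_continuous_map[OF
      chart_homeomorphic[OF assms(1)]] this]
  have "openin (subtopology T U) {q\<in>U. x q \<in> x ` U \<inter> W}"
    by (simp only: topspace_chart[OF assms(1)])
  moreover have "{q\<in>U. x q \<in> x ` U \<inter> W} = {q\<in>U. x q \<in> W}" by auto
  ultimately show ?thesis using openin_trans_full chart_domain[OF assms(1)] by metis
qed

lemma chart_open_image:
  assumes "(U, x) \<in> A" "openin T N"
  shows "open (x ` (U \<inter> N))"
proof -
  have "openin (subtopology T U) (U \<inter> N)"
    using assms(2) by (simp add: openin_subtopology_Int2)
  then have "openin (top_of_set (x ` U)) (x ` (U \<inter> N))"
    using homeomorphic_imp_open_map[OF chart_homeomorphic[OF assms(1)]] by (simp add: open_map_def)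
  then show ?thesis using chart_image[OF assms(1)] openin_open_eq by blast
qed

text \<open>The definition of smoothness near a point provides some chart; smoothness of the transition maps
  transfers it to a chart of one's choice.\<close>

lemma smooth_near_chart:
  assumes V: "(V, y) \<in> A" "p \<in> V" and f: "smooth_near A p f"
  obtains W where "y p \<in> W" "W \<subseteq> y ` V" "smooth_on W (f \<circ> inv_into V y)"
proof -
  from f obtain U x W0 where U: "(U, x) \<in> A" "p \<in> U" "x p \<in> W0" "W0 \<subseteq> x ` U"
    and W0: "smooth_on W0 (f \<circ> inv_into U x)" by (auto simp: smooth_near_def)
  have tr: "smooth_on (y ` (V \<inter> U)) (x \<circ> inv_into V y)"
    using smooth_transition[OF V(1) U(1)] .
  define W where "W = y ` (V \<inter> U) \<inter> (x \<circ> inv_into V y) -` W0"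
  have "open W" unfolding W_def
    using continuous_open_preimage[OF smooth_on_imp_continuous_on[OF tr] smooth_on_open[OF tr]
        smooth_on_open[OF W0]] .
  then have "smooth_on W (\<lambda>z. (f \<circ> inv_into U x) ((x \<circ> inv_into V y) z))"
    by (intro smooth_on_compose[OF W0] smooth_on_subset[OF tr]) (auto simp: W_def)
  then have "smooth_on W (f \<circ> inv_into V y)"
    by (rule smooth_on_cong) (auto simp: W_def V U)
  moreover have "y p \<in> W" using U V by (simp add: W_def)
  moreover have "W \<subseteq> y ` V" by (auto simp: W_def)
  ultimately show ?thesis using that by blast
qed

lemma smooth_nearI:
  "(U, x) \<in> A \<Longrightarrow> p \<in> U \<Longrightarrow> x p \<in> W \<Longrightarrow> W \<subseteq> x ` U \<Longrightarrow> smooth_on W (f \<circ> inv_into U x) \<Longrightarrow>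
    smooth_near A p f"
  unfolding smooth_near_def by blast

lemma smooth_near_points: "smooth_near A p f \<Longrightarrow> p \<in> points A"
  by (auto simp: smooth_near_def points_def)

lemma smooth_near_const:
  assumes "p \<in> points A"
  shows "smooth_near A p (\<lambda>_. c)"
proof -
  obtain U x where U: "(U, x) \<in> A" "p \<in> U" using assms by (rule chart_at)
  show ?thesis
    by (rule smooth_nearI[OF U, where W="x ` U"])
      (use U in \<open>auto simp: o_def intro: smooth_on_const chart_image\<close>)
qed

lemma
  assumes "smooth_near A p f" "smooth_near A p g"
  shows smooth_near_add: "smooth_near A p (\<lambda>q. f q + g q)"
    and smooth_near_mult: "smooth_near A p (\<lambda>q. f q * g q)"
proof -
  obtain U x where U: "(U, x) \<in> A" "p \<in> U" using smooth_near_points[OF assms(1)] by (rule chart_at)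
  obtain W1 W2 where W: "x p \<in> W1" "W1 \<subseteq> x ` U" "x p \<in> W2"
    "smooth_on W1 (f \<circ> inv_into U x)" "smooth_on W2 (g \<circ> inv_into U x)"
    using assms smooth_near_chart[OF U] by metis
  then have *: "smooth_on (W1 \<inter> W2) (f \<circ> inv_into U x)" "smooth_on (W1 \<inter> W2) (g \<circ> inv_into U x)"
    using smooth_on_subset smooth_on_open open_Int by (metis inf_le1, metis inf_le2)
  show "smooth_near A p (\<lambda>q. f q + g q)"
    by (rule smooth_nearI[OF U, where W="W1 \<inter> W2"])
      (use W smooth_on_add[OF *] in \<open>auto simp: o_def\<close>)
  show "smooth_near A p (\<lambda>q. f q * g q)"
    by (rule smooth_nearI[OF U, where W="W1 \<inter> W2"])
      (use W smooth_on_mult[OF *] in \<open>auto simp: o_def\<close>)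
qed

lemma smooth_near_cmult: "smooth_near A p f \<Longrightarrow> smooth_near A p (\<lambda>q. c * f q)"
  by (rule smooth_near_mult[OF smooth_near_const[OF smooth_near_points]])

lemma smooth_near_sum:
  assumes "p \<in> points A" "\<And>i. i \<in> I \<Longrightarrow> smooth_near A p (f i)"
  shows "smooth_near A p (\<lambda>q. \<Sum>i\<in>I. f i q)"
  using assms(2)
  by (induction I rule: infinite_finite_induct)
    (simp_all add: smooth_near_const smooth_near_add assms(1))

lemma smooth_near_cong:
  assumes "smooth_near A p f" "openin T N" "p \<in> N" "\<And>q. q \<in> N \<Longrightarrow> f q = g q"
  shows "smooth_near A p g"
proof -
  obtain U x where U: "(U, x) \<in> A" "p \<in> U" using smooth_near_points[OF assms(1)] by (rule chart_at)
  obtain W where W: "x p \<in> W" "W \<subseteq> x ` U" "smooth_on W (f \<circ> inv_into U x)"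
    using assms(1) smooth_near_chart[OF U] by metis
  let ?W = "W \<inter> x ` (U \<inter> N)"
  have "smooth_on ?W (f \<circ> inv_into U x)"
    using W(3) by (rule smooth_on_subset)
      (use W chart_open_image[OF U(1) assms(2)] smooth_on_open in auto)
  then have "smooth_on ?W (g \<circ> inv_into U x)"
    by (rule smooth_on_cong) (use U assms in auto)
  then show ?thesis by (rule smooth_nearI[OF U, rotated 2]) (use U W assms in auto)
qed

lemma smooth_near_coordinate:
  assumes "(U, x) \<in> A" "p \<in> U" "bounded_linear L"
  shows "smooth_near A p (\<lambda>q. L (x q))"
proof (rule smooth_nearI[OF assms(1,2), where W="x ` U"])
  have "smooth_on (x ` U) (\<lambda>y. L y)"
    by (rule smooth_on_bounded_linear[OF assms(3) smooth_on_id[OF chart_image[OF assms(1)]]])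
  then show "smooth_on (x ` U) ((\<lambda>q. L (x q)) \<circ> inv_into U x)"
    by (rule smooth_on_cong) (auto simp: assms)
qed (use assms in auto)

lemma smooth_near_all_chart:
  assumes U: "(U, x) \<in> A" and f: "\<And>p. p \<in> U \<Longrightarrow> smooth_near A p f"
  shows "smooth_on (x ` U) (f \<circ> inv_into U x)"
proof -
  let ?S = "{W. W \<subseteq> x ` U \<and> smooth_on W (f \<circ> inv_into U x)}"
  have "x ` U \<subseteq> \<Union>?S" using smooth_near_chart[OF U _ f] by blast
  then have "\<Union>?S = x ` U" by blast
  then show ?thesis using smooth_on_Union[of ?S] by fastforce
qed

text \<open>The preimage \<open>K\<close> of a closed ball is compact, hence closed since the manifold is Hausdorff. This makes
  the extension of the bump function by \<open>0\<close> smooth outside the chart.\<close>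

lemma bump_function:
  assumes U: "(U, x) \<in> A" "p \<in> U" and N: "openin T N" "p \<in> N"
  obtains \<rho> K where "\<rho> \<in> smooth_functions A" "\<rho> p = 1" "closedin T K" "K \<subseteq> U \<inter> N"
    "\<And>q. q \<notin> K \<Longrightarrow> \<rho> q = 0"
proof -
  obtain e where e: "e > 0" "cball (x p) e \<subseteq> x ` (U \<inter> N)"
    using chart_open_image[OF U(1) N(1)] U N open_contains_cball by (metis IntI imageI)
  obtain \<beta> :: "'e \<Rightarrow> real" where \<beta>: "smooth_on UNIV \<beta>" "\<beta> (x p) = 1" "\<And>y. y \<notin> cball (x p) e \<Longrightarrow> \<beta> y = 0"
    using smooth_bump[OF e(1)] by metis
  define \<rho> where "\<rho> q = (if q \<in> U then \<beta> (x q) else 0)" for q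
  define K where "K = {q\<in>U. x q \<in> cball (x p) e}"
  obtain g where g: "homeomorphic_maps (subtopology T U) (top_of_set (x ` U)) x g"
    using chart_homeomorphic[OF U(1)] homeomorphic_map_maps by metis
  have "compactin (top_of_set (x ` U)) (cball (x p) e)"
    using e(2) by (auto simp: compactin_subtopology)
  then have "compactin (subtopology T U) (g ` cball (x p) e)"
    using g image_compactin unfolding homeomorphic_maps_def by metis
  moreover have "g ` cball (x p) e = K"
  proof -
    have gx: "g (x q) = q" if "q \<in> U" for q
      using g that topspace_chart[OF U(1)] by (simp add: homeomorphic_maps_def)
    have "\<exists>q\<in>U. y = x q" if "y \<in> cball (x p) e" for y using e(2) that by blast
    then show ?thesis unfolding K_def using gx by (force simp del: mem_cball)
  qed
  ultimately have "closedin T K"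
    using compactin_imp_closedin[OF Hausdorff] compactin_subtopology by metis
  moreover have K: "K \<subseteq> U \<inter> N"
  proof
    fix q assume q: "q \<in> K"
    then obtain q' where "q' \<in> U \<inter> N" "x q = x q'" using e(2) by (auto simp: K_def)
    then show "q \<in> U \<inter> N" using q inj_onD[OF chart_inj[OF U(1)]] by (auto simp: K_def)
  qed
  moreover have \<rho>0: "\<rho> q = 0" if "q \<notin> K" for q using that \<beta>(3) by (auto simp: \<rho>_def K_def)
  moreover have "smooth_near A q \<rho>" if q: "q \<in> points A" for q
  proof (cases "q \<in> U")
    case True
    have "smooth_on (x ` U) \<beta>" using smooth_on_subset[OF \<beta>(1)] chart_image[OF U(1)] by simp
    then have "smooth_on (x ` U) (\<rho> \<circ> inv_into U x)"
      by (rule smooth_on_cong) (auto simp: \<rho>_def U)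
    then show ?thesis by (rule smooth_nearI[OF U(1) True, rotated 2]) (use True in auto)
  next
    case False
    have "openin T (topspace T - K)" using \<open>closedin T K\<close> by blast
    then show ?thesis
      by (rule smooth_near_cong[OF smooth_near_const[OF q, of 0]])
        (use False K q \<rho>0 points_eq_topspace in auto)
  qed
  ultimately show ?thesis using that[of \<rho> K] U \<beta>(2) by (auto simp: smooth_functions_def \<rho>_def)
qed

text \<open>Multiplication by a bump function globalizes functions that are only smooth on its support.\<close>

lemma smooth_near_cutoff:
  assumes \<rho>: "\<rho> \<in> smooth_functions A" and K: "closedin T K" "\<And>q. q \<notin> K \<Longrightarrow> \<rho> q = 0"
    and q: "q \<in> points A" "q \<in> K \<Longrightarrow> smooth_near A q g"
  shows "smooth_near A q (\<lambda>q. \<rho> q * g q)"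
proof (cases "q \<in> K")
  case True
  then show ?thesis using \<rho> q by (intro smooth_near_mult) (auto simp: smooth_functions_def)
next
  case False
  have "openin T (topspace T - K)" using K by blast
  then show ?thesis
    by (rule smooth_near_cong[OF smooth_near_const[OF q(1), of 0]])
      (use False K q points_eq_topspace in auto)
qed

lemma
  assumes "v \<in> tangent_space A p"
  shows tangent_not_smooth: "\<not> smooth_near A p f \<Longrightarrow> v f = 0"
    and tangent_add: "smooth_near A p f \<Longrightarrow> smooth_near A p g \<Longrightarrow> v (\<lambda>q. f q + g q) = v f + v g"
    and tangent_cmult: "smooth_near A p f \<Longrightarrow> v (\<lambda>q. c * f q) = c * v f"
    and tangent_mult: "smooth_near A p f \<Longrightarrow> smooth_near A p g \<Longrightarrow>
      v (\<lambda>q. f q * g q) = v f * g p + f p * v g"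
  using assms by (auto simp: tangent_space_def)

lemma tangent_const:
  assumes "v \<in> tangent_space A p" "p \<in> points A"
  shows "v (\<lambda>_. c) = 0"
proof -
  have "v (\<lambda>q. 1 * 1) = v (\<lambda>_. 1) * 1 + 1 * v (\<lambda>_. 1)"
    by (rule tangent_mult[OF assms(1) smooth_near_const[OF assms(2)] smooth_near_const[OF assms(2)]])
  then have "v (\<lambda>_. 1) = 0" by simp
  then show ?thesis using tangent_cmult[OF assms(1) smooth_near_const[OF assms(2)], of c 1] by simp
qed

lemma tangent_sum:
  assumes "v \<in> tangent_space A p" "p \<in> points A" "\<And>i. i \<in> I \<Longrightarrow> smooth_near A p (f i)"
  shows "v (\<lambda>q. \<Sum>i\<in>I. f i q) = (\<Sum>i\<in>I. v (f i))"
  using assms(3)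
  by (induction I rule: infinite_finite_induct)
    (simp_all add: tangent_const[OF assms(1,2)] tangent_add[OF assms(1)] smooth_near_sum assms(2))

text \<open>If \<open>\<rho>\<close> is a bump function supported where \<open>f = g\<close>, then \<open>\<rho> f = \<rho> g\<close>, and the product rule at \<open>p\<close>
  gives the claim.\<close>

lemma tangent_cong:
  assumes v: "v \<in> tangent_space A p" and N: "openin T N" "p \<in> N" "\<And>q. q \<in> N \<Longrightarrow> f q = g q"
  shows "v f = v g"
proof (cases "smooth_near A p f")
  case True
  then have g: "smooth_near A p g" using N smooth_near_cong by metis
  obtain U x where U: "(U, x) \<in> A" "p \<in> U" using smooth_near_points[OF True] by (rule chart_at)
  obtain \<rho> K where \<rho>: "\<rho> \<in> smooth_functions A" "\<rho> p = 1" "K \<subseteq> U \<inter> N" "\<And>q. q \<notin> K \<Longrightarrow> \<rho> q = 0"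
    using bump_function[OF U N(1,2)] by metis
  have "smooth_near A p \<rho>" using \<rho>(1) smooth_near_points[OF True] by (auto simp: smooth_functions_def)
  moreover have "(\<lambda>q. \<rho> q * f q) = (\<lambda>q. \<rho> q * g q)" using \<rho>(3,4) N(3) by fastforce
  ultimately have "v \<rho> * f p + \<rho> p * v f = v \<rho> * g p + \<rho> p * v g"
    using tangent_mult[OF v] True g by metis
  then show ?thesis using \<rho>(2) N by simp
next
  case False
  then have "\<not> smooth_near A p g" using N smooth_near_cong by metis
  then show ?thesis using False tangent_not_smooth[OF v] by simp
qed

lemma tangent_space_add:
  "v \<in> tangent_space A p \<Longrightarrow> w \<in> tangent_space A p \<Longrightarrow> (\<lambda>f. v f + w f) \<in> tangent_space A p"
  by (auto simp: tangent_space_def algebra_simps)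

lemma tangent_space_scale:
  "v \<in> tangent_space A p \<Longrightarrow> (\<lambda>f. c * v f) \<in> tangent_space A p"
  by (auto simp: tangent_space_def algebra_simps)

lemma zero_in_tangent_space: "(\<lambda>f. 0) \<in> tangent_space A p"
  by (simp add: tangent_space_def)

lemma tangent_space_sum:
  assumes "\<And>i. i \<in> I \<Longrightarrow> v i \<in> tangent_space A p"
  shows "(\<lambda>f. \<Sum>i\<in>I. v i f) \<in> tangent_space A p"
  using assms by (induction I rule: infinite_finite_induct)
    (simp_all add: zero_in_tangent_space tangent_space_add)

lemma coord_vector_in_tangent_space:
  assumes U: "(U, x) \<in> A" "p \<in> U"
  shows "coord_vector A (U, x) b p \<in> tangent_space A p"
proof -
  have d: "((f \<circ> inv_into U x) has_derivative frechet_derivative (f \<circ> inv_into U x) (at (x p))) (at (x p))"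
    if "smooth_near A p f" for f
    using smooth_near_chart[OF U that] smooth_on_has_derivative by metis
  have "frechet_derivative ((\<lambda>q. f q + g q) \<circ> inv_into U x) (at (x p)) b =
      frechet_derivative (f \<circ> inv_into U x) (at (x p)) b +
      frechet_derivative (g \<circ> inv_into U x) (at (x p)) b"
    if "smooth_near A p f" "smooth_near A p g" for f g
    using frechet_derivative_eqI[OF has_derivative_add[OF d[OF that(1)] d[OF that(2)]]]
    by (simp add: o_def)
  moreover have "frechet_derivative ((\<lambda>q. c * f q) \<circ> inv_into U x) (at (x p)) b =
      c * frechet_derivative (f \<circ> inv_into U x) (at (x p)) b"
    if "smooth_near A p f" for f c
    using frechet_derivative_eqI[OF has_derivative_mult_right[OF d[OF that(1)], of c]]
    by (simp add: o_def)
  moreover have "frechet_derivative ((\<lambda>q. f q * g q) \<circ> inv_into U x) (at (x p)) b =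
      frechet_derivative (f \<circ> inv_into U x) (at (x p)) b * g p +
      f p * frechet_derivative (g \<circ> inv_into U x) (at (x p)) b"
    if "smooth_near A p f" "smooth_near A p g" for f g
    using frechet_derivative_eqI[OF has_derivative_mult[OF d[OF that(1)] d[OF that(2)]]] U
    by (simp add: o_def)
  ultimately show ?thesis
    by (simp add: tangent_space_def coord_vector_def smooth_near_add smooth_near_mult smooth_near_cmult)
qed

lemma coord_vector_coordinate:
  assumes U: "(U, x) \<in> A" "p \<in> U"
  shows "coord_vector A (U, x) b p (\<lambda>q. x q \<bullet> c) = b \<bullet> c"
proof -
  have "((\<lambda>y. y \<bullet> c) has_derivative (\<lambda>h. h \<bullet> c)) (at (x p))"
    by (auto intro!: derivative_eq_intros)
  then have "(((\<lambda>q. x q \<bullet> c) \<circ> inv_into U x) has_derivative (\<lambda>h. h \<bullet> c)) (at (x p))"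
    by (rule has_derivative_transform_within_open[where s="x ` U"]) (use U chart_image in auto)
  then show ?thesis
    using smooth_near_coordinate[OF U bounded_linear_inner_left]
    by (simp add: coord_vector_def frechet_derivative_eqI)
qed

text \<open>Hadamard's lemma writes \<open>f\<close> as \<open>f p + (\<Sum>b. (x\<^sup>b - x\<^sup>b(p)) g\<^sub>b)\<close> near \<open>p\<close>. The product rule leaves
  \<open>v(x\<^sup>b) g\<^sub>b(p)\<close> of each summand, and \<open>g\<^sub>b(p)\<close> is the partial derivative. If \<open>f\<close> is not smooth near \<open>p\<close>,
  both sides are \<open>0\<close> by convention.\<close>

lemma tangent_expansion:
  assumes U: "(U, x) \<in> A" "p \<in> U" and v: "v \<in> tangent_space A p"
  shows "v f = (\<Sum>b\<in>Basis. v (\<lambda>q. x q \<bullet> b) * coord_vector A (U, x) b p f)"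
proof (cases "smooth_near A p f")
  case True
  note p = chart_points[OF U]
  obtain W where W: "x p \<in> W" "W \<subseteq> x ` U" "smooth_on W (f \<circ> inv_into U x)"
    using smooth_near_chart[OF U True] .
  obtain e where e: "e > 0" "ball (x p) e \<subseteq> W"
    using W smooth_on_open open_contains_ball by metis
  let ?B = "ball (x p) e"
  have "smooth_on ?B (f \<circ> inv_into U x)" by (rule smooth_on_subset[OF W(3)]) (use e in auto)
  then obtain g where
    g: "\<And>b. b \<in> Basis \<Longrightarrow> smooth_on ?B (g b)"
      "\<And>b. b \<in> Basis \<Longrightarrow> g b (x p) = frechet_derivative (f \<circ> inv_into U x) (at (x p)) b"
      "\<And>y. y \<in> ?B \<Longrightarrow> (f \<circ> inv_into U x) y =
        (f \<circ> inv_into U x) (x p) + (\<Sum>b\<in>Basis. ((y - x p) \<bullet> b) * g b y)"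
    using Hadamard[OF _ e(1)] by blast
  have gs: "smooth_near A p (\<lambda>q. g b (x q))" if "b \<in> Basis" for b
  proof (rule smooth_nearI[OF U, where W="?B"])
    show "smooth_on ?B ((\<lambda>q. g b (x q)) \<circ> inv_into U x)"
      by (rule smooth_on_cong[OF g(1)[OF that]]) (use e W in \<open>auto simp: f_inv_into_f subset_iff\<close>)
  qed (use e W in auto)
  have xs: "smooth_near A p (\<lambda>q. x q \<bullet> b)" for b
    by (rule smooth_near_coordinate[OF U bounded_linear_inner_left])
  have xs': "smooth_near A p (\<lambda>q. x q \<bullet> b + - (x p \<bullet> b))" for b
    by (intro smooth_near_add xs smooth_near_const p)
  have "v f = v (\<lambda>q. f p + (\<Sum>b\<in>Basis. (x q \<bullet> b + - (x p \<bullet> b)) * g b (x q)))"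
  proof (rule tangent_cong[OF v chart_open_preimage[OF U(1) open_ball]])
    fix q assume "q \<in> {q\<in>U. x q \<in> ?B}"
    then show "f q = f p + (\<Sum>b\<in>Basis. (x q \<bullet> b + - (x p \<bullet> b)) * g b (x q))"
      using g(3)[of "x q"] U by (auto simp: inner_diff_left)
  qed (use U e in auto)
  also have "\<dots> = v (\<lambda>q. \<Sum>b\<in>Basis. (x q \<bullet> b + - (x p \<bullet> b)) * g b (x q))"
    using tangent_add[OF v smooth_near_const[OF p] smooth_near_sum[OF p smooth_near_mult[OF xs' gs]]]
      tangent_const[OF v p] by simp
  also have "\<dots> = (\<Sum>b\<in>Basis. v (\<lambda>q. (x q \<bullet> b + - (x p \<bullet> b)) * g b (x q)))"
    by (intro tangent_sum[OF v p] smooth_near_mult xs' gs)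
  also have "\<dots> = (\<Sum>b\<in>Basis. v (\<lambda>q. x q \<bullet> b) * coord_vector A (U, x) b p f)"
  proof (rule sum.cong[OF refl])
    fix b :: 'e assume b: "b \<in> Basis"
    have "v (\<lambda>q. x q \<bullet> b + - (x p \<bullet> b)) = v (\<lambda>q. x q \<bullet> b) + v (\<lambda>_. - (x p \<bullet> b))"
      by (rule tangent_add[OF v xs smooth_near_const[OF p]])
    then have "v (\<lambda>q. x q \<bullet> b + - (x p \<bullet> b)) = v (\<lambda>q. x q \<bullet> b)"
      using tangent_const[OF v p] by simp
    then show "v (\<lambda>q. (x q \<bullet> b + - (x p \<bullet> b)) * g b (x q)) =
        v (\<lambda>q. x q \<bullet> b) * coord_vector A (U, x) b p f"
      using tangent_mult[OF v xs' gs[OF b]] g(2)[OF b] True by (simp add: coord_vector_def)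
  qed
  finally show ?thesis .
next
  case False
  then show ?thesis using tangent_not_smooth[OF v] by (simp add: coord_vector_def)
qed


section \<open>Vector fields\<close>

lemma
  assumes "X \<in> vector_fields A"
  shows vector_field_tangent: "p \<in> points A \<Longrightarrow> X p \<in> tangent_space A p"
    and vector_field_outside: "p \<notin> points A \<Longrightarrow> X p = (\<lambda>_. 0)"
    and vector_field_smooth: "(U, x) \<in> A \<Longrightarrow> p \<in> U \<Longrightarrow> b \<in> Basis \<Longrightarrow>
      smooth_near A p (\<lambda>q. X q (\<lambda>q'. x q' \<bullet> b))"
  using assms by (auto simp: vector_fields_def)

lemma vector_fieldI:
  assumes "\<And>p. p \<in> points A \<Longrightarrow> X p \<in> tangent_space A p"
    and "\<And>p. p \<notin> points A \<Longrightarrow> X p = (\<lambda>_. 0)"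
    and "\<And>U x b p. (U, x) \<in> A \<Longrightarrow> b \<in> Basis \<Longrightarrow> p \<in> U \<Longrightarrow> smooth_near A p (\<lambda>q. X q (\<lambda>q'. x q' \<bullet> b))"
  shows "X \<in> vector_fields A"
  using assms unfolding vector_fields_def by blast

lemma smooth_functions_const: "(\<lambda>_. c) \<in> smooth_functions A"
  by (simp add: smooth_functions_def smooth_near_const)

lemma smooth_functions_mult:
  "f \<in> smooth_functions A \<Longrightarrow> g \<in> smooth_functions A \<Longrightarrow> (\<lambda>q. f q * g q) \<in> smooth_functions A"
  by (simp add: smooth_functions_def smooth_near_mult)

lemma smooth_functions_near: "f \<in> smooth_functions A \<Longrightarrow> p \<in> points A \<Longrightarrow> smooth_near A p f"
  by (simp add: smooth_functions_def)

lemma field_add_in_vector_fields: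
  assumes "X \<in> vector_fields A" "Y \<in> vector_fields A"
  shows "field_add X Y \<in> vector_fields A"
  unfolding field_add_def
proof (rule vector_fieldI)
  show "(\<lambda>f. X p f + Y p f) \<in> tangent_space A p" if "p \<in> points A" for p
    using that assms by (intro tangent_space_add vector_field_tangent)
  show "smooth_near A p (\<lambda>q. X q (\<lambda>q'. x q' \<bullet> b) + Y q (\<lambda>q'. x q' \<bullet> b))"
    if "(U, x) \<in> A" "b \<in> Basis" "p \<in> U" for U x b p
    using that assms by (intro smooth_near_add vector_field_smooth)
qed (simp add: assms vector_field_outside)

lemma field_scale_in_vector_fields:
  assumes "h \<in> smooth_functions A" "X \<in> vector_fields A"
  shows "field_scale h X \<in> vector_fields A"
  unfolding field_scale_def
proof (rule vector_fieldI)
  show "(\<lambda>f. h p * X p f) \<in> tangent_space A p" if "p \<in> points A" for p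
    using that assms by (intro tangent_space_scale vector_field_tangent)
  show "smooth_near A p (\<lambda>q. h q * X q (\<lambda>q'. x q' \<bullet> b))"
    if "(U, x) \<in> A" "b \<in> Basis" "p \<in> U" for U x b p
    using that assms chart_points by (intro smooth_near_mult vector_field_smooth smooth_functions_near)
qed (simp add: assms vector_field_outside)

lemma zero_in_vector_fields: "(\<lambda>p f. 0) \<in> vector_fields A"
  by (rule vector_fieldI) (simp_all add: zero_in_tangent_space smooth_near_const chart_points)

lemma sum_in_vector_fields:
  assumes "finite I" "\<And>i. i \<in> I \<Longrightarrow> X i \<in> vector_fields A"
  shows "(\<lambda>p f. \<Sum>i\<in>I. X i p f) \<in> vector_fields A"
  using assms
proof (induction I)
  case (insert j I)
  then show ?case
    using field_add_in_vector_fields[of "X j" "\<lambda>p f. \<Sum>i\<in>I. X i p f"] by (simp add: field_add_def)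
qed (simp add: zero_in_vector_fields)

lemma coord_vector_component_smooth:
  assumes U: "(U, x) \<in> A" "p \<in> U" and V: "(V, y) \<in> A" "p \<in> V" and b: "b \<in> Basis"
  shows "smooth_near A p (\<lambda>q. coord_vector A (U, x) b q (\<lambda>q'. y q' \<bullet> c))"
proof (rule smooth_nearI[OF U, where W="x ` (U \<inter> V)"])
  have "smooth_on (x ` (U \<inter> V)) (\<lambda>z. (y \<circ> inv_into U x) z \<bullet> c)"
    by (rule smooth_on_bounded_linear[OF bounded_linear_inner_left smooth_transition[OF U(1) V(1)]])
  from smooth_on_partial_derivative[OF this b]
  show "smooth_on (x ` (U \<inter> V))
      ((\<lambda>q. coord_vector A (U, x) b q (\<lambda>q'. y q' \<bullet> c)) \<circ> inv_into U x)"
  proof (rule smooth_on_cong)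
    fix z assume "z \<in> x ` (U \<inter> V)"
    then obtain q where q: "q \<in> U" "q \<in> V" "z = x q" by auto
    have "smooth_near A q (\<lambda>q'. y q' \<bullet> c)"
      using smooth_near_coordinate[OF V(1) q(2) bounded_linear_inner_left] .
    then show "frechet_derivative (\<lambda>z. (y \<circ> inv_into U x) z \<bullet> c) (at z) b =
        ((\<lambda>q. coord_vector A (U, x) b q (\<lambda>q'. y q' \<bullet> c)) \<circ> inv_into U x) z"
      using q U by (simp add: coord_vector_def o_def)
  qed
qed (use U V in auto)

lemma cutoff_coord_field:
  assumes U: "(U, x) \<in> A" and \<rho>: "\<rho> \<in> smooth_functions A"
    and K: "closedin T K" "K \<subseteq> U" "\<And>q. q \<notin> K \<Longrightarrow> \<rho> q = 0" and b: "b \<in> Basis"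
  shows "field_scale \<rho> (coord_vector A (U, x) b) \<in> vector_fields A"
proof (rule vector_fieldI)
  fix p
  show "field_scale \<rho> (coord_vector A (U, x) b) p \<in> tangent_space A p"
  proof (cases "p \<in> K")
    case True
    then show ?thesis using K coord_vector_in_tangent_space[OF U] tangent_space_scale
      by (auto simp: field_scale_def)
  next
    case False
    then show ?thesis using K(3) by (simp add: field_scale_def zero_in_tangent_space)
  qed
  show "field_scale \<rho> (coord_vector A (U, x) b) p = (\<lambda>_. 0)" if "p \<notin> points A"
  proof -
    have "p \<notin> K" using K(2) chart_points[OF U] that by auto
    then show ?thesis using K(3) by (simp add: field_scale_def)
  qed
next
  fix V y c p assume V: "(V, y) \<in> A" "p \<in> V"
  show "smooth_near A p (\<lambda>q. field_scale \<rho> (coord_vector A (U, x) b) q (\<lambda>q'. y q' \<bullet> c))"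
    unfolding field_scale_def
    by (rule smooth_near_cutoff[OF \<rho> K(1,3) chart_points[OF V]])
      (use K(2) coord_vector_component_smooth[OF U _ V b] in auto)
qed

lemma extend_vector_field:
  assumes "p \<in> points A" "v \<in> tangent_space A p"
  shows "extend A p v \<in> vector_fields A" "extend A p v p = v"
proof -
  obtain U x where U: "(U, x) \<in> A" "p \<in> U" using assms(1) by (rule chart_at)
  obtain \<rho> K where \<rho>: "\<rho> \<in> smooth_functions A" "\<rho> p = 1" "closedin T K" "K \<subseteq> U" "\<And>q. q \<notin> K \<Longrightarrow> \<rho> q = 0"
    using bump_function[OF U, of U] U chart_domain by (metis Int_absorb)
  let ?X = "\<lambda>q f. \<Sum>b\<in>Basis. field_scale (\<lambda>_. v (\<lambda>q. x q \<bullet> b)) (field_scale \<rho> (coord_vector A (U, x) b)) q f"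
  have "?X \<in> vector_fields A"
    by (rule sum_in_vector_fields[OF finite_Basis],
        rule field_scale_in_vector_fields[OF smooth_functions_const],
        rule cutoff_coord_field[OF U(1) \<rho>(1,3,4,5)])
  moreover have "?X p = v"
    by (rule ext) (simp add: field_scale_def \<rho>(2) tangent_expansion[OF U assms(2), symmetric])
  ultimately have "\<exists>X. X \<in> vector_fields A \<and> X p = v" by blast
  from someI_ex[OF this] show "extend A p v \<in> vector_fields A" "extend A p v p = v"
    by (auto simp: extend_def)
qed

text \<open>Each local factor of the expansion \<open>X = (\<Sum>b. X\<^sup>b \<partial>\<^sub>b)\<close> needs a factor \<open>\<rho>\<close> of its own to become
  global, so it is \<open>\<rho>\<^sup>2 X\<close> that is a combination of global vector fields with global coefficients.\<close>

lemma cutoff_expansion: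
  assumes U: "(U, x) \<in> A" and K: "K \<subseteq> U" "\<And>q. q \<notin> K \<Longrightarrow> \<rho> q = 0" and X: "X \<in> vector_fields A"
  shows "field_scale (\<lambda>q. \<rho> q * \<rho> q) X = (\<lambda>q f. \<Sum>b\<in>Basis.
    field_scale (\<lambda>q. \<rho> q * X q (\<lambda>q'. x q' \<bullet> b)) (field_scale \<rho> (coord_vector A (U, x) b)) q f)"
proof (intro ext)
  fix q f
  show "field_scale (\<lambda>q. \<rho> q * \<rho> q) X q f = (\<Sum>b\<in>Basis.
    field_scale (\<lambda>q. \<rho> q * X q (\<lambda>q'. x q' \<bullet> b)) (field_scale \<rho> (coord_vector A (U, x) b)) q f)"
  proof (cases "q \<in> K")
    case True
    then have q: "q \<in> U" using K by auto
    show ?thesis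
      by (subst (1) field_scale_def, subst tangent_expansion[OF U q vector_field_tangent[OF X chart_points[OF U q]]])
        (simp add: field_scale_def sum_distrib_left algebra_simps)
  qed (simp add: field_scale_def K)
qed

lemma cutoff_component_smooth:
  assumes U: "(U, x) \<in> A" and \<rho>: "\<rho> \<in> smooth_functions A"
    and K: "closedin T K" "K \<subseteq> U" "\<And>q. q \<notin> K \<Longrightarrow> \<rho> q = 0"
    and X: "X \<in> vector_fields A" and b: "b \<in> Basis"
  shows "(\<lambda>q. \<rho> q * X q (\<lambda>q'. x q' \<bullet> b)) \<in> smooth_functions A"
  unfolding smooth_functions_def
  using smooth_near_cutoff[OF \<rho> K(1,3)] vector_field_smooth[OF X U _ b] K(2) by auto

section \<open>Connections at a point\<close>

context
  fixes nabla :: "'a field \<Rightarrow> 'a field \<Rightarrow> 'a field"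
  assumes nabla: "connection A nabla"
begin

lemma
  assumes "X \<in> vector_fields A" "Y \<in> vector_fields A"
  shows nabla_in_vector_fields: "nabla X Y \<in> vector_fields A"
    and nabla_add_left: "X' \<in> vector_fields A \<Longrightarrow>
      nabla (field_add X X') Y = field_add (nabla X Y) (nabla X' Y)"
    and nabla_scale_left: "h \<in> smooth_functions A \<Longrightarrow>
      nabla (field_scale h X) Y = field_scale h (nabla X Y)"
    and nabla_add_right: "Y' \<in> vector_fields A \<Longrightarrow>
      nabla X (field_add Y Y') = field_add (nabla X Y) (nabla X Y')"
    and nabla_Leibniz: "h \<in> smooth_functions A \<Longrightarrow> nabla X (field_scale h Y) =
      field_add (field_scale (\<lambda>p. X p h) Y) (field_scale h (nabla X Y))"
  using nabla assms unfolding connection_def by blast+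

lemma nabla_zero_left:
  assumes "Y \<in> vector_fields A"
  shows "nabla (\<lambda>p f. 0) Y = (\<lambda>p f. 0)"
  using nabla_scale_left[OF zero_in_vector_fields assms smooth_functions_const[of 0]]
  by (simp add: field_scale_def)

lemma nabla_zero_right:
  assumes "X \<in> vector_fields A"
  shows "nabla X (\<lambda>p f. 0) = (\<lambda>p f. 0)"
  using nabla_Leibniz[OF assms zero_in_vector_fields smooth_functions_const[of 0]]
  by (simp add: field_scale_def field_add_def)

lemma nabla_sum_left:
  assumes "Y \<in> vector_fields A" "finite I" "\<And>i. i \<in> I \<Longrightarrow> X i \<in> vector_fields A"
  shows "nabla (\<lambda>p f. \<Sum>i\<in>I. X i p f) Y = (\<lambda>p f. \<Sum>i\<in>I. nabla (X i) Y p f)"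
  using assms(2,3)
proof (induction I)
  case (insert j I)
  then show ?case
    using nabla_add_left[of "X j" Y "\<lambda>p f. \<Sum>i\<in>I. X i p f"] assms(1) sum_in_vector_fields[of I X]
    by (simp add: field_add_def)
qed (simp add: nabla_zero_left assms(1))

lemma nabla_sum_right:
  assumes "X \<in> vector_fields A" "finite I" "\<And>i. i \<in> I \<Longrightarrow> Y i \<in> vector_fields A"
  shows "nabla X (\<lambda>p f. \<Sum>i\<in>I. Y i p f) = (\<lambda>p f. \<Sum>i\<in>I. nabla X (Y i) p f)"
  using assms(2,3)
proof (induction I)
  case (insert j I)
  then show ?case
    using nabla_add_right[of X "Y j" "\<lambda>p f. \<Sum>i\<in>I. Y i p f"] assms(1) sum_in_vector_fields[of I Y]
    by (simp add: field_add_def)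
qed (simp add: nabla_zero_right assms(1))

text \<open>Since \<open>\<rho>\<^sup>2 = 1\<close> at \<open>p\<close>, linearity over functions allows replacing \<open>X\<close> by \<open>\<rho>\<^sup>2 X\<close>, whose expansion has
  coefficients that vanish at \<open>p\<close>.\<close>

lemma nabla_left_zero_at:
  assumes X: "X \<in> vector_fields A" and Y: "Y \<in> vector_fields A" and p: "p \<in> points A" "X p = (\<lambda>_. 0)"
  shows "nabla X Y p = (\<lambda>_. 0)"
proof
  fix f
  obtain U x where U: "(U, x) \<in> A" "p \<in> U" using p(1) by (rule chart_at)
  obtain \<rho> K where \<rho>: "\<rho> \<in> smooth_functions A" "\<rho> p = 1"
    and K: "closedin T K" "K \<subseteq> U" "\<And>q. q \<notin> K \<Longrightarrow> \<rho> q = 0"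
    using bump_function[OF U, of U] U chart_domain by (metis Int_absorb)
  let ?h = "\<lambda>b q. \<rho> q * X q (\<lambda>q'. x q' \<bullet> b)" and ?E = "\<lambda>b. field_scale \<rho> (coord_vector A (U, x) b)"
  have E: "?E b \<in> vector_fields A" if "b \<in> Basis" for b
    by (rule cutoff_coord_field[OF U(1) \<rho>(1) K that])
  have h: "?h b \<in> smooth_functions A" if "b \<in> Basis" for b
    by (rule cutoff_component_smooth[OF U(1) \<rho>(1) K X that])
  have "nabla X Y p f = field_scale (\<lambda>q. \<rho> q * \<rho> q) (nabla X Y) p f"
    using \<rho>(2) by (simp add: field_scale_def)
  also have "\<dots> = nabla (field_scale (\<lambda>q. \<rho> q * \<rho> q) X) Y p f"
    by (simp add: nabla_scale_left[OF X Y smooth_functions_mult[OF \<rho>(1) \<rho>(1)]])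
  also have "\<dots> = (\<Sum>b\<in>Basis. nabla (field_scale (?h b) (?E b)) Y p f)"
  proof -
    have "field_scale (\<lambda>q. \<rho> q * \<rho> q) X = (\<lambda>q f. \<Sum>b\<in>Basis. field_scale (?h b) (?E b) q f)"
      by (rule cutoff_expansion[OF U(1) K(2) _ X]) (rule K(3))
    then show ?thesis
      using nabla_sum_left[OF Y, of Basis "\<lambda>b. field_scale (?h b) (?E b)"]
        field_scale_in_vector_fields[OF h E] by simp
  qed
  also have "\<dots> = (\<Sum>b\<in>Basis. field_scale (?h b) (nabla (?E b) Y) p f)"
    by (intro sum.cong refl) (simp add: nabla_scale_left[OF E Y h])
  also have "\<dots> = 0" by (simp add: field_scale_def p(2))
  finally show "nabla X Y p f = 0" .
qed

lemma nabla_left_cong_at: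
  assumes X: "X \<in> vector_fields A" "X' \<in> vector_fields A" and Y: "Y \<in> vector_fields A"
    and p: "p \<in> points A" "X p = X' p"
  shows "nabla X Y p = nabla X' Y p"
proof -
  let ?m = "field_scale (\<lambda>_. -1) X'"
  have m: "?m \<in> vector_fields A" by (intro field_scale_in_vector_fields smooth_functions_const X)
  have "nabla (field_add X ?m) Y p = (\<lambda>_. 0)"
    by (rule nabla_left_zero_at[OF field_add_in_vector_fields[OF X(1) m] Y p(1)])
      (simp add: field_add_def field_scale_def p(2))
  then show ?thesis
    unfolding nabla_add_left[OF X(1) Y m] nabla_scale_left[OF X(2) Y smooth_functions_const]
    by (simp add: field_add_def field_scale_def fun_eq_iff)
qed

text \<open>In coordinates, the Christoffel terms of \<open>\<nabla>\<^sub>W Z\<close> vanish where \<open>Z\<close> does. As in the proof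
  of \<open>nabla_left_zero_at\<close>, \<open>Z\<close> is replaced by \<open>\<rho>\<^sup>2 Z\<close>; the additional term of the Leibniz rule is a multiple of \<open>Z\<^sub>p = 0\<close>.\<close>

lemma nabla_right_zero_at:
  assumes W: "W \<in> vector_fields A" and Z: "Z \<in> vector_fields A" and U: "(U, x) \<in> A" "p \<in> U"
    and p: "Z p = (\<lambda>_. 0)"
  shows "nabla W Z p f = (\<Sum>b\<in>Basis. W p (\<lambda>q. Z q (\<lambda>q'. x q' \<bullet> b)) * coord_vector A (U, x) b p f)"
proof -
  have pA: "p \<in> points A" by (rule chart_points[OF U])
  have Wp: "W p \<in> tangent_space A p" by (rule vector_field_tangent[OF W pA])
  obtain \<rho> K where \<rho>: "\<rho> \<in> smooth_functions A" "\<rho> p = 1"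
    and K: "closedin T K" "K \<subseteq> U" "\<And>q. q \<notin> K \<Longrightarrow> \<rho> q = 0"
    using bump_function[OF U, of U] U chart_domain by (metis Int_absorb)
  let ?h = "\<lambda>b q. \<rho> q * Z q (\<lambda>q'. x q' \<bullet> b)" and ?E = "\<lambda>b. field_scale \<rho> (coord_vector A (U, x) b)"
  have E: "?E b \<in> vector_fields A" if "b \<in> Basis" for b
    by (rule cutoff_coord_field[OF U(1) \<rho>(1) K that])
  have h: "?h b \<in> smooth_functions A" if "b \<in> Basis" for b
    by (rule cutoff_component_smooth[OF U(1) \<rho>(1) K Z that])
  have "nabla W Z p f = nabla W (field_scale (\<lambda>q. \<rho> q * \<rho> q) Z) p f"
    unfolding nabla_Leibniz[OF W Z smooth_functions_mult[OF \<rho>(1) \<rho>(1)]]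
    using \<rho>(2) p by (simp add: field_add_def field_scale_def)
  also have "\<dots> = (\<Sum>b\<in>Basis. nabla W (field_scale (?h b) (?E b)) p f)"
  proof -
    have "field_scale (\<lambda>q. \<rho> q * \<rho> q) Z = (\<lambda>q f. \<Sum>b\<in>Basis. field_scale (?h b) (?E b) q f)"
      by (rule cutoff_expansion[OF U(1) K(2) _ Z]) (rule K(3))
    then show ?thesis
      using nabla_sum_right[OF W, of Basis "\<lambda>b. field_scale (?h b) (?E b)"]
        field_scale_in_vector_fields[OF h E] by simp
  qed
  also have "\<dots> = (\<Sum>b\<in>Basis. W p (\<lambda>q. Z q (\<lambda>q'. x q' \<bullet> b)) * coord_vector A (U, x) b p f)"
  proof (rule sum.cong[OF refl])
    fix b :: 'e assume b: "b \<in> Basis"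
    have "W p (?h b) = W p (\<lambda>q. Z q (\<lambda>q'. x q' \<bullet> b))"
      using tangent_mult[OF Wp smooth_functions_near[OF \<rho>(1) pA] vector_field_smooth[OF Z U b]] \<rho>(2) p
      by simp
    then show "nabla W (field_scale (?h b) (?E b)) p f =
        W p (\<lambda>q. Z q (\<lambda>q'. x q' \<bullet> b)) * coord_vector A (U, x) b p f"
      unfolding nabla_Leibniz[OF W E[OF b] h[OF b]]
      using \<rho>(2) p by (simp add: field_add_def field_scale_def)
  qed
  finally show ?thesis .
qed

text \<open>If \<open>X\<close> and \<open>Y\<close> agree at \<open>p\<close>, the Christoffel terms of their covariant derivatives cancel: this is
  the preceding lemma for \<open>Z = X - Y\<close>.\<close>

lemma nabla_component_diff:
  assumes W: "W \<in> vector_fields A" and X: "X \<in> vector_fields A" and Y: "Y \<in> vector_fields A"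
    and U: "(U, x) \<in> A" "p \<in> U" and p: "X p = Y p" and b: "b \<in> Basis"
  shows "nabla W X p (\<lambda>q. x q \<bullet> b) - nabla W Y p (\<lambda>q. x q \<bullet> b) =
    W p (\<lambda>q. X q (\<lambda>q'. x q' \<bullet> b)) - W p (\<lambda>q. Y q (\<lambda>q'. x q' \<bullet> b))"
proof -
  have pA: "p \<in> points A" by (rule chart_points[OF U])
  have Wp: "W p \<in> tangent_space A p" by (rule vector_field_tangent[OF W pA])
  let ?m = "field_scale (\<lambda>_. -1) Y"
  let ?c = "\<lambda>X q. X q (\<lambda>q'. x q' \<bullet> b)"
  have m: "?m \<in> vector_fields A" by (intro field_scale_in_vector_fields smooth_functions_const Y)
  have "nabla W X p (\<lambda>q. x q \<bullet> b) - nabla W Y p (\<lambda>q. x q \<bullet> b) = nabla W (field_add X ?m) p (\<lambda>q. x q \<bullet> b)"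
    unfolding nabla_add_right[OF W X m] nabla_Leibniz[OF W Y smooth_functions_const]
    by (simp add: field_add_def field_scale_def tangent_const[OF Wp pA])
  also have "\<dots> = (\<Sum>c\<in>Basis. W p (\<lambda>q. field_add X ?m q (\<lambda>q'. x q' \<bullet> c)) * (if c = b then 1 else 0))"
    by (subst nabla_right_zero_at[OF W field_add_in_vector_fields[OF X m] U])
      (simp_all add: field_add_def field_scale_def p coord_vector_coordinate[OF U] inner_Basis b)
  also have "\<dots> = W p (?c (field_add X ?m))"
    using b by (simp add: if_distrib cong: if_cong)
  also have "\<dots> = W p (?c X) - W p (?c Y)"
    using tangent_add[OF Wp vector_field_smooth[OF X U b] smooth_near_cmult[OF vector_field_smooth[OF Y U b], of "-1"]]
      tangent_cmult[OF Wp vector_field_smooth[OF Y U b], of "-1"]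
    by (simp add: field_add_def field_scale_def)
  finally show ?thesis .
qed

end

end

section \<open>The chain rule for tangent vectors\<close>

text \<open>For the coordinate map \<open>x\<close> of a chart, this is the fibre coordinate of the natural chart. For any other
  vector-valued map \<open>s\<close>, it is the value at \<open>v\<close> of the differential of \<open>s\<close>.\<close>

definition coord_components :: "('a \<Rightarrow> 'e::euclidean_space) \<Rightarrow> 'a tangent \<Rightarrow> 'e" where
  "coord_components x v = (\<Sum>b\<in>Basis. v (\<lambda>q. x q \<bullet> b) *\<^sub>R b)"

text \<open>With the base point, this is the inverse of a natural chart of the tangent bundle.\<close>

definition chart_vector ::
  "('a, 'e::euclidean_space) chart set \<Rightarrow> ('a, 'e) chart \<Rightarrow> 'a \<Rightarrow> 'e \<Rightarrow> 'a tangent" where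
  "chart_vector A C q c = (\<lambda>f. \<Sum>b\<in>Basis. (c \<bullet> b) * coord_vector A C b q f)"

lemma coord_components_inner: "b \<in> Basis \<Longrightarrow> coord_components x v \<bullet> b = v (\<lambda>q. x q \<bullet> b)"
  by (simp add: coord_components_def inner_sum_left_Basis)

context smooth_manifold
begin

lemma smooth_near_vector_valued:
  fixes s :: "'a \<Rightarrow> 'f::euclidean_space"
  assumes U: "(U, x) \<in> A" "p \<in> U" and s: "\<And>c. c \<in> Basis \<Longrightarrow> smooth_near A p (\<lambda>q. s q \<bullet> c)"
  obtains W where "x p \<in> W" "W \<subseteq> x ` U" "smooth_on W (s \<circ> inv_into U x)"
proof -
  have "\<forall>c\<in>Basis. \<exists>W. x p \<in> W \<and> W \<subseteq> x ` U \<and> smooth_on W ((\<lambda>q. s q \<bullet> c) \<circ> inv_into U x)"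
    using smooth_near_chart[OF U s] by metis
  from bchoice[OF this] obtain W where W: "\<And>c. c \<in> Basis \<Longrightarrow> x p \<in> W c \<and> W c \<subseteq> x ` U \<and>
      smooth_on (W c) ((\<lambda>q. s q \<bullet> c) \<circ> inv_into U x)" by blast
  let ?W = "\<Inter>c\<in>(Basis :: 'f set). W c"
  have "open (W c)" if "c \<in> Basis" for c using W[OF that] smooth_on_open by blast
  then have open_W: "open ?W" by (intro open_INT) auto
  have "smooth_on ?W (\<lambda>y. \<Sum>c\<in>Basis. ((\<lambda>q. s q \<bullet> c) \<circ> inv_into U x) y *\<^sub>R c)"
  proof (rule smooth_on_sum[OF open_W])
    fix c :: 'f assume c: "c \<in> Basis"
    have "smooth_on ?W ((\<lambda>q. s q \<bullet> c) \<circ> inv_into U x)"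
      using smooth_on_subset[OF _ open_W, of "W c"] W[OF c] c by blast
    from smooth_on_scaleR[OF this smooth_on_const[OF open_W]]
    show "smooth_on ?W (\<lambda>y. ((\<lambda>q. s q \<bullet> c) \<circ> inv_into U x) y *\<^sub>R c)" .
  qed
  then have "smooth_on ?W (s \<circ> inv_into U x)" by (simp add: o_def euclidean_representation)
  moreover have "x p \<in> ?W" using W by blast
  moreover have "?W \<subseteq> x ` U" using W nonempty_Basis by blast
  ultimately show ?thesis using that by blast
qed

text \<open>The chain rule for tangent vectors, which only know functions on the manifold: expanding \<open>w\<close> in a
  chart reduces it to the chain rule in a Euclidean space.\<close>

lemma
  fixes s :: "'a \<Rightarrow> 'f::euclidean_space" and F :: "'f \<Rightarrow> real"
  assumes w: "w \<in> tangent_space A p" and p: "p \<in> points A"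
    and s: "\<And>c. c \<in> Basis \<Longrightarrow> smooth_near A p (\<lambda>q. s q \<bullet> c)"
    and F: "smooth_on R F" "s p \<in> R"
  shows smooth_near_compose: "smooth_near A p (\<lambda>q. F (s q))"
    and tangent_chain_rule: "w (\<lambda>q. F (s q)) = frechet_derivative F (at (s p)) (coord_components s w)"
proof -
  obtain U x where U: "(U, x) \<in> A" "p \<in> U" using p by (rule chart_at)
  obtain W where W: "x p \<in> W" "W \<subseteq> x ` U" and sW: "smooth_on W (s \<circ> inv_into U x)"
    using smooth_near_vector_valued[OF U s] by blast
  define S where "S = W \<inter> (s \<circ> inv_into U x) -` R"
  have open_S: "open S" unfolding S_def
    using continuous_open_preimage[OF smooth_on_imp_continuous_on[OF sW] smooth_on_open[OF sW]
        smooth_on_open[OF F(1)]] .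
  have "smooth_on S (\<lambda>y. F ((s \<circ> inv_into U x) y))"
    by (rule smooth_on_compose[OF F(1) smooth_on_subset[OF sW open_S]]) (auto simp: S_def)
  moreover have xS: "x p \<in> S" using W F(2) U by (simp add: S_def)
  ultimately show near: "smooth_near A p (\<lambda>q. F (s q))"
    using W by (intro smooth_nearI[OF U, where W=S]) (auto simp: S_def o_def)
  define D where "D = frechet_derivative F (at (s p))"
  define s' where "s' = frechet_derivative (s \<circ> inv_into U x) (at (x p))"
  have s': "((s \<circ> inv_into U x) has_derivative s') (at (x p))"
    unfolding s'_def by (rule smooth_on_has_derivative[OF sW W(1)])
  have D: "(F has_derivative D) (at (s p))"
    unfolding D_def by (rule smooth_on_has_derivative[OF F])
  have "(F has_derivative D) (at ((s \<circ> inv_into U x) (x p)))" using D U by simp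
  from has_derivative_compose[OF s' this]
  have 1: "coord_vector A (U, x) b p (\<lambda>q. F (s q)) = D (s' b)" for b
    using near by (simp add: coord_vector_def o_def frechet_derivative_eqI)
  have 2: "coord_vector A (U, x) b p (\<lambda>q. s q \<bullet> c) = s' b \<bullet> c" if "c \<in> Basis" for b c
    using s[OF that] has_derivative_inner_left[OF s', of c]
    by (simp add: coord_vector_def o_def frechet_derivative_eqI)
  have "w (\<lambda>q. F (s q)) = (\<Sum>b\<in>Basis. w (\<lambda>q. x q \<bullet> b) *\<^sub>R D (s' b))"
    by (subst tangent_expansion[OF U w]) (simp add: 1)
  also have "\<dots> = D (\<Sum>b\<in>Basis. w (\<lambda>q. x q \<bullet> b) *\<^sub>R s' b)"
    using has_derivative_linear[OF D] by (simp add: linear_sum linear_cmul)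
  also have "(\<Sum>b\<in>Basis. w (\<lambda>q. x q \<bullet> b) *\<^sub>R s' b) = coord_components s w"
  proof (rule euclidean_eqI)
    fix c :: 'f assume c: "c \<in> Basis"
    have "coord_components s w \<bullet> c = (\<Sum>b\<in>Basis. w (\<lambda>q. x q \<bullet> b) * coord_vector A (U, x) b p (\<lambda>q. s q \<bullet> c))"
      unfolding coord_components_inner[OF c] by (rule tangent_expansion[OF U w])
    then show "(\<Sum>b\<in>Basis. w (\<lambda>q. x q \<bullet> b) *\<^sub>R s' b) \<bullet> c = coord_components s w \<bullet> c"
      by (simp add: inner_sum_left 2[OF c])
  qed
  finally show "w (\<lambda>q. F (s q)) = D (coord_components s w)" .
qed

section \<open>The tangent bundle\<close>

lemma chart_vector_in_tangent_space:
  "(U, x) \<in> A \<Longrightarrow> q \<in> U \<Longrightarrow> chart_vector A (U, x) q c \<in> tangent_space A q"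
  unfolding chart_vector_def
  by (intro tangent_space_sum tangent_space_scale coord_vector_in_tangent_space)

lemma coord_components_chart_vector:
  assumes U: "(U, x) \<in> A" "q \<in> U"
  shows "coord_components x (chart_vector A (U, x) q c) = c"
proof (rule euclidean_eqI)
  fix b :: 'e assume b: "b \<in> Basis"
  then have "coord_components x (chart_vector A (U, x) q c) \<bullet> b = (\<Sum>b'\<in>Basis. (c \<bullet> b') * (b' \<bullet> b))"
    by (simp add: coord_components_inner chart_vector_def coord_vector_coordinate[OF U])
  then show "coord_components x (chart_vector A (U, x) q c) \<bullet> b = c \<bullet> b"
    by (simp add: euclidean_inner[of c b] inner_commute[of b])
qed

lemma chart_vector_coord_components:
  assumes "(U, x) \<in> A" "q \<in> U" "v \<in> tangent_space A q"
  shows "chart_vector A (U, x) q (coord_components x v) = v"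
  by (rule ext) (simp add: chart_vector_def coord_components_inner tangent_expansion[OF assms, symmetric])

lemma natural_chart_eq:
  "natural_chart A (U, x) = (SIGMA p:U. tangent_space A p, \<lambda>(p, v). (x p, coord_components x v))"
  by (simp add: natural_chart_def coord_components_def)

lemma inv_natural_chart:
  assumes U: "(U, x) \<in> A" "q \<in> U"
  shows "inv_into (SIGMA p:U. tangent_space A p) (\<lambda>(p, v). (x p, coord_components x v)) (x q, c) =
    (q, chart_vector A (U, x) q c)"
proof (rule inv_into_f_eq)
  show "inj_on (\<lambda>(p, v). (x p, coord_components x v)) (SIGMA p:U. tangent_space A p)"
  proof (rule inj_onI)
    fix u u'
    assume "u \<in> (SIGMA p:U. tangent_space A p)" "u' \<in> (SIGMA p:U. tangent_space A p)"
      and eq: "(case u of (p, v) \<Rightarrow> (x p, coord_components x v)) = (case u' of (p, v) \<Rightarrow> (x p, coord_components x v))"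
    then obtain p v p' v' where u: "u = (p, v)" "u' = (p', v')" "p \<in> U" "p' \<in> U"
      "v \<in> tangent_space A p" "v' \<in> tangent_space A p'" by blast
    then have "x p = x p'" and c: "coord_components x v = coord_components x v'" using eq by auto
    then have "p = p'" using inj_onD[OF chart_inj[OF U(1)]] u by blast
    then show "u = u'" using chart_vector_coord_components[OF U(1)] u c by metis
  qed
qed (use U chart_vector_in_tangent_space coord_components_chart_vector in auto)

lemma natural_chart_image:
  assumes U: "(U, x) \<in> A"
  shows "x ` U \<times> UNIV \<subseteq> (\<lambda>(p, v). (x p, coord_components x v)) ` (SIGMA p:U. tangent_space A p)"
proof
  fix z assume "z \<in> x ` U \<times> (UNIV :: 'e set)"
  then obtain q c where q: "q \<in> U" "z = (x q, c)" by auto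
  then have "z = (\<lambda>(p, v). (x p, coord_components x v)) (q, chart_vector A (U, x) q c)"
    using coord_components_chart_vector[OF U] by simp
  then show "z \<in> (\<lambda>(p, v). (x p, coord_components x v)) ` (SIGMA p:U. tangent_space A p)"
    using q chart_vector_in_tangent_space[OF U] by blast
qed

text \<open>Here \<open>G\<close> is the expression of \<open>F\<close> in natural coordinates. Writing the points of the bundle as coordinate
  vectors in \<open>eq\<close> spares the user of the lemma the inverse of a natural chart.\<close>

lemma smooth_near_tangent_atlasI:
  assumes U: "(U, x) \<in> A" and u: "p \<in> U" "v \<in> tangent_space A p"
    and W: "x p \<in> W" "W \<subseteq> x ` U" and G: "smooth_on (W \<times> UNIV) G"
    and eq: "\<And>q c. q \<in> U \<Longrightarrow> F (q, chart_vector A (U, x) q c) = G (x q, c)"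
  shows "smooth_near (tangent_atlas A) (p, v) F"
proof -
  let ?S = "SIGMA p:U. tangent_space A p" and ?\<psi> = "\<lambda>(p, v). (x p, coord_components x v)"
  have chart: "(?S, ?\<psi>) \<in> tangent_atlas A"
    unfolding tangent_atlas_def natural_chart_eq[symmetric] using U by blast
  moreover have "smooth_on (W \<times> UNIV) (F \<circ> inv_into ?S ?\<psi>)"
    using G
  proof (rule smooth_on_cong)
    fix z assume "z \<in> W \<times> (UNIV :: 'e set)"
    then obtain q c where q: "q \<in> U" "z = (x q, c)" using W by auto
    then show "G z = (F \<circ> inv_into ?S ?\<psi>) z" by (simp add: inv_natural_chart[OF U] eq)
  qed
  moreover have "W \<times> UNIV \<subseteq> ?\<psi> ` ?S" using natural_chart_image[OF U] W by blast
  moreover have "(p, v) \<in> ?S" "?\<psi> (p, v) \<in> W \<times> UNIV" using u W by auto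
  ultimately have "\<exists>W. (p, v) \<in> ?S \<and> ?\<psi> (p, v) \<in> W \<and> W \<subseteq> ?\<psi> ` ?S \<and>
      smooth_on W (F \<circ> inv_into ?S ?\<psi>)" by (intro exI conjI)
  with chart show ?thesis unfolding smooth_near_def by (intro bexI[where x="(?S, ?\<psi>)"]) simp_all
qed

lemma smooth_near_tangent_atlasE:
  assumes "smooth_near (tangent_atlas A) (p, v) F"
  obtains U x R G where "(U, x) \<in> A" "p \<in> U" "smooth_on R G" "(x p, coord_components x v) \<in> R"
    and "\<And>q c. q \<in> U \<Longrightarrow> F (q, chart_vector A (U, x) q c) = G (x q, c)"
proof -
  obtain S \<psi> R where S: "(S, \<psi>) \<in> tangent_atlas A" "(p, v) \<in> S" "\<psi> (p, v) \<in> R"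
    "smooth_on R (F \<circ> inv_into S \<psi>)"
    using assms unfolding smooth_near_def by blast
  obtain U x where U: "(U, x) \<in> A" "natural_chart A (U, x) = (S, \<psi>)"
    using S(1) unfolding tangent_atlas_def by force
  then have eq: "S = (SIGMA p:U. tangent_space A p)" "\<psi> = (\<lambda>(p, v). (x p, coord_components x v))"
    by (simp_all add: natural_chart_eq)
  show ?thesis
    by (rule that[OF U(1) _ S(4)]) (use S inv_natural_chart[OF U(1)] in \<open>auto simp: eq\<close>)
qed

lemma smooth_near_fst:
  assumes f: "smooth_near A p f" and v: "v \<in> tangent_space A p"
  shows "smooth_near (tangent_atlas A) (p, v) (f \<circ> fst)"
proof -
  obtain U x where U: "(U, x) \<in> A" "p \<in> U" using smooth_near_points[OF f] by (rule chart_at)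
  obtain W where W: "x p \<in> W" "W \<subseteq> x ` U" "smooth_on W (f \<circ> inv_into U x)"
    using smooth_near_chart[OF U f] .
  have o: "open (W \<times> (UNIV :: 'e set))" using smooth_on_open[OF W(3)] by (intro open_Times) auto
  have "smooth_on (W \<times> (UNIV :: 'e set)) (\<lambda>z. (f \<circ> inv_into U x) (fst z))"
    by (rule smooth_on_compose[OF W(3) smooth_on_bounded_linear[OF bounded_linear_fst smooth_on_id[OF o]]])
      auto
  then show ?thesis
    by (rule smooth_near_tangent_atlasI[OF U v W(1,2)]) (simp add: U)
qed

text \<open>The chain rule for \<open>F\<close> after the section \<open>q \<mapsto> (q, X q)\<close>: in natural coordinates, the derivative of the
  section maps \<open>w\<close> to the pair of \<open>w\<close> and the derivatives of the components of \<open>X\<close>.\<close>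

lemma section_derivative:
  assumes w: "w \<in> tangent_space A p" and X: "X \<in> vector_fields A" and U: "(U, x) \<in> A" "p \<in> U"
    and G: "smooth_on R G" "(x p, coord_components x (X p)) \<in> R"
    and F: "\<And>q c. q \<in> U \<Longrightarrow> F (q, chart_vector A (U, x) q c) = G (x q, c)"
  shows "smooth_near A p (\<lambda>q. F (q, X q))"
    and "w (\<lambda>q. F (q, X q)) = frechet_derivative G (at (x p, coord_components x (X p)))
      (coord_components x w, coord_components (\<lambda>q. coord_components x (X q)) w)"
proof -
  let ?s = "\<lambda>q. (x q, coord_components x (X q))"
  have p: "p \<in> points A" by (rule chart_points[OF U])
  have s: "smooth_near A p (\<lambda>q. ?s q \<bullet> c)" if "c \<in> Basis" for c
    using that smooth_near_coordinate[OF U bounded_linear_inner_left] vector_field_smooth[OF X U]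
    by (auto simp: Basis_prod_def coord_components_inner)
  have eq: "G (?s q) = F (q, X q)" if "q \<in> U" for q
    using F[OF that, of "coord_components x (X q)"]
      chart_vector_coord_components[OF U(1) that vector_field_tangent[OF X chart_points[OF U(1) that]]]
    by simp
  show "smooth_near A p (\<lambda>q. F (q, X q))"
    using smooth_near_compose[OF w p s G] chart_domain[OF U(1)] U(2) eq by (rule smooth_near_cong)
  have "coord_components ?s w = (coord_components x w, coord_components (\<lambda>q. coord_components x (X q)) w)"
    by (rule euclidean_eqI) (auto simp: Basis_prod_def coord_components_inner)
  then show "w (\<lambda>q. F (q, X q)) = frechet_derivative G (at (x p, coord_components x (X p)))
      (coord_components x w, coord_components (\<lambda>q. coord_components x (X q)) w)"
    using tangent_chain_rule[OF w p s G] tangent_cong[OF w chart_domain[OF U(1)] U(2) eq] by simp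
qed


context
  fixes nabla :: "'a field \<Rightarrow> 'a field \<Rightarrow> 'a field"
  assumes nabla: "connection A nabla"
begin

text \<open>By \<open>section_derivative\<close>, the right-hand side is the derivative of the coordinate expression of \<open>F\<close> in
  the vertical direction \<open>\<zeta>\<close> with components \<open>W\<^sub>p(X\<^sup>b) - W\<^sub>p(Y\<^sup>b)\<close>. These are the components of the difference
  of the covariant derivatives, which is the direction of the line on the left-hand side.\<close>

lemma section_derivative_diff:
  assumes W: "W \<in> vector_fields A" and X: "X \<in> vector_fields A" and Y: "Y \<in> vector_fields A"
    and p: "p \<in> points A" and XY: "X p = v" "Y p = v"
    and F: "smooth_near (tangent_atlas A) (p, v) F"
  shows "((\<lambda>t. F (p, \<lambda>f. v f + t * (nabla W X p f - nabla W Y p f))) has_real_derivative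
    W p (\<lambda>q. F (q, X q)) - W p (\<lambda>q. F (q, Y q))) (at 0)"
proof -
  obtain U x R G where U: "(U, x) \<in> A" "p \<in> U"
    and G: "smooth_on R G" "(x p, coord_components x v) \<in> R"
    and FG: "\<And>q c. q \<in> U \<Longrightarrow> F (q, chart_vector A (U, x) q c) = G (x q, c)"
    using smooth_near_tangent_atlasE[OF F] by blast
  note Wp = vector_field_tangent[OF W p]
  define D where "D = frechet_derivative G (at (x p, coord_components x v))"
  have D: "(G has_derivative D) (at (x p, coord_components x v))"
    unfolding D_def by (rule smooth_on_has_derivative[OF G])
  define \<zeta> where "\<zeta> = coord_components (\<lambda>q. coord_components x (X q)) (W p) -
    coord_components (\<lambda>q. coord_components x (Y q)) (W p)"
  have "W p (\<lambda>q. F (q, X q)) - W p (\<lambda>q. F (q, Y q)) = D (0, \<zeta>)"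
    using section_derivative(2)[OF Wp X U G(1) _ FG] section_derivative(2)[OF Wp Y U G(1) _ FG] G(2) XY
      linear_diff[OF has_derivative_linear[OF D], symmetric]
    by (simp add: D_def \<zeta>_def)
  moreover define z where "z = (\<lambda>f. nabla W X p f - nabla W Y p f)"
  have v: "v \<in> tangent_space A p" using vector_field_tangent[OF X p] XY by simp
  have z: "z \<in> tangent_space A p"
    using tangent_space_add[OF vector_field_tangent[OF nabla_in_vector_fields[OF nabla W X] p]
        tangent_space_scale[OF vector_field_tangent[OF nabla_in_vector_fields[OF nabla W Y] p], of "-1"]]
    by (simp add: z_def)
  have "F (p, \<lambda>f. v f + t * z f) = G (x p, coord_components x v + t *\<^sub>R \<zeta>)" for t
  proof -
    have coords: "coord_components x (\<lambda>f. v f + t * z f) = coord_components x v + t *\<^sub>R \<zeta>"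
    proof (rule euclidean_eqI)
      fix b :: 'e assume b: "b \<in> Basis"
      have "z (\<lambda>q. x q \<bullet> b) = \<zeta> \<bullet> b"
        using nabla_component_diff[OF nabla W X Y U _ b] XY b
        by (simp add: z_def \<zeta>_def inner_diff_left coord_components_inner)
      then show "coord_components x (\<lambda>f. v f + t * z f) \<bullet> b = (coord_components x v + t *\<^sub>R \<zeta>) \<bullet> b"
        using b by (simp add: coord_components_inner inner_add_left)
    qed
    have mem: "(\<lambda>f. v f + t * z f) \<in> tangent_space A p"
      by (intro tangent_space_add tangent_space_scale v z)
    show ?thesis
      using FG[OF U(2), of "coord_components x (\<lambda>f. v f + t * z f)"]
      unfolding chart_vector_coord_components[OF U mem] unfolding coords by simp
  qed
  moreover have "((\<lambda>t. G (x p, coord_components x v + t *\<^sub>R \<zeta>)) has_real_derivative D (0, \<zeta>)) (at 0)"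
  proof -
    have "((\<lambda>t. (x p, coord_components x v + t *\<^sub>R \<zeta>)) has_derivative (\<lambda>t. t *\<^sub>R (0, \<zeta>))) (at 0)"
      by (auto intro!: derivative_eq_intros)
    moreover have "(G has_derivative D) (at (x p, coord_components x v + 0 *\<^sub>R \<zeta>))" using D by simp
    ultimately have "((\<lambda>t. G (x p, coord_components x v + t *\<^sub>R \<zeta>)) has_derivative (\<lambda>t. D (t *\<^sub>R (0, \<zeta>)))) (at 0)"
      by (rule has_derivative_compose)
    then show ?thesis
      unfolding linear_cmul[OF has_derivative_linear[OF D]] has_field_derivative_def
      by (simp add: mult_commute_abs)
  qed
  ultimately show ?thesis by (simp add: z_def)
qed

section \<open>The geodesic spray\<close>

text \<open>Any section that is parallel along \<open>w\<close> computes the lift. Two such sections give the same vector on the tangent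
  bundle because the line in \<open>section_derivative_diff\<close> is then constant.\<close>

lemma horizontal_lift_eq:
  assumes W: "W \<in> vector_fields A" and Y: "Y \<in> vector_fields A" and p: "p \<in> points A"
    and YW: "Y p = v" "W p = w" and hor: "nabla W Y p = (\<lambda>_. 0)"
  shows "horizontal_lift A nabla (p, v) w = differential (tangent_atlas A) (\<lambda>q. (q, Y q)) p w"
  unfolding horizontal_lift_def
proof (rule the_equality)
  let ?\<xi> = "differential (tangent_atlas A) (\<lambda>q. (q, Y q)) p w"
  have v: "v \<in> tangent_space A p" and w: "w \<in> tangent_space A p"
    using vector_field_tangent[OF Y p] vector_field_tangent[OF W p] YW by auto
  have proj: "differential A fst (p, v) (differential (tangent_atlas A) (\<lambda>q. (q, Y q)) p w) = w"
    if "w \<in> tangent_space A p" "Y p = v" for Y w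
  proof
    fix f
    show "differential A fst (p, v) (differential (tangent_atlas A) (\<lambda>q. (q, Y q)) p w) f = w f"
    proof (cases "smooth_near A p f")
      case True
      then show ?thesis using smooth_near_fst[OF True v] that by (simp add: differential_def o_def)
    next
      case False
      then show ?thesis using tangent_not_smooth[OF that(1)] by (simp add: differential_def)
    qed
  qed
  have "?\<xi> \<in> horizontal_space A nabla (p, v)"
    unfolding horizontal_space_def using W Y YW hor by auto
  then show "?\<xi> \<in> horizontal_space A nabla (p, v) \<and> differential A fst (p, v) ?\<xi> = w"
    using proj[where Y=Y and w=w] w YW(1) by blast
  fix \<xi> assume \<xi>: "\<xi> \<in> horizontal_space A nabla (p, v) \<and> differential A fst (p, v) \<xi> = w"
  then obtain Y' W' where Y': "\<xi> = differential (tangent_atlas A) (\<lambda>q. (q, Y' q)) p (W' p)"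
    "Y' \<in> vector_fields A" "W' \<in> vector_fields A" "Y' p = v" "nabla W' Y' p = (\<lambda>_. 0)"
    unfolding horizontal_space_def by auto
  have W': "W' p = w" using proj[where Y=Y' and w="W' p"] vector_field_tangent[OF Y'(3) p] Y'(4) \<xi> Y'(1) by simp
  have hor': "nabla W Y' p = (\<lambda>_. 0)"
    using nabla_left_cong_at[OF nabla W Y'(3) Y'(2) p] YW W' Y'(5) by simp
  show "\<xi> = ?\<xi>"
  proof
    fix F
    show "\<xi> F = ?\<xi> F"
    proof (cases "smooth_near (tangent_atlas A) (p, v) F")
      case True
      have "((\<lambda>t. F (p, \<lambda>f. v f + t * (nabla W Y' p f - nabla W Y p f))) has_real_derivative 0) (at 0)"
        by (simp add: hor hor')
      then have "W p (\<lambda>q. F (q, Y' q)) = W p (\<lambda>q. F (q, Y q))"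
        using DERIV_unique[OF _ section_derivative_diff[OF W Y'(2) Y p Y'(4) YW(1) True]] by force
      then show ?thesis using YW Y' W' by (simp add: differential_def o_def)
    next
      case False
      then show ?thesis using YW Y' by (simp add: differential_def)
    qed
  qed
qed

text \<open>If \<open>h\<close> vanishes at \<open>p\<close>, then adding \<open>h \<nabla>\<^sub>X X\<close> to \<open>X\<close> changes the covariant derivative along \<open>X\<close> at \<open>p\<close> by
  \<open>(X\<^sub>p h) (\<nabla>\<^sub>X X)\<^sub>p\<close>, and \<open>X\<^sub>p h\<close> can be made \<open>-1\<close> with a multiple of a coordinate, unless \<open>X\<^sub>p = 0\<close>.
  In that case, \<open>\<nabla>\<^sub>X X\<close> vanishes at \<open>p\<close> already.\<close>

lemma horizontal_section_exists:
  assumes X: "X \<in> vector_fields A" and p: "p \<in> points A"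
  obtains Y where "Y \<in> vector_fields A" "Y p = X p" "nabla X Y p = (\<lambda>_. 0)"
proof (cases "X p = (\<lambda>_. 0)")
  case True
  then show ?thesis using that[OF X] nabla_left_zero_at[OF nabla X X p] by simp
next
  case False
  note Xp = vector_field_tangent[OF X p]
  obtain U x where U: "(U, x) \<in> A" "p \<in> U" using p by (rule chart_at)
  obtain \<rho> K where \<rho>: "\<rho> \<in> smooth_functions A" "\<rho> p = 1"
    and K: "closedin T K" "K \<subseteq> U" "\<And>q. q \<notin> K \<Longrightarrow> \<rho> q = 0"
    using bump_function[OF U, of U] U chart_domain by (metis Int_absorb)
  have "\<exists>b\<in>Basis. X p (\<lambda>q. x q \<bullet> b) \<noteq> 0"
  proof (rule ccontr)
    assume "\<not> (\<exists>b\<in>Basis. X p (\<lambda>q. x q \<bullet> b) \<noteq> 0)"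
    then have "X p f = 0" for f by (subst tangent_expansion[OF U Xp]) simp
    then show False using False by blast
  qed
  then obtain b where b: "b \<in> Basis" "X p (\<lambda>q. x q \<bullet> b) \<noteq> 0" by blast
  \<comment> \<open>The affine function of one coordinate with \<open>l p = 0\<close> and \<open>X\<^sub>p l = -1\<close>; \<open>h\<close> is its cut-off.\<close>
  define l where "l q = (-1 / X p (\<lambda>q. x q \<bullet> b)) * (x q \<bullet> b + - (x p \<bullet> b))" for q
  have l: "smooth_near A q l" if "q \<in> U" for q
    unfolding l_def
    by (intro smooth_near_cmult smooth_near_add smooth_near_const chart_points[OF U(1) that]
        smooth_near_coordinate[OF U(1) that bounded_linear_inner_left])
  have x: "smooth_near A p (\<lambda>q. x q \<bullet> b)"
    by (rule smooth_near_coordinate[OF U bounded_linear_inner_left])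
  have "X p (\<lambda>q. x q \<bullet> b + - (x p \<bullet> b)) = X p (\<lambda>q. x q \<bullet> b) + X p (\<lambda>_. - (x p \<bullet> b))"
    by (rule tangent_add[OF Xp x smooth_near_const[OF p]])
  then have "X p l = -1"
    unfolding l_def tangent_cmult[OF Xp smooth_near_add[OF x smooth_near_const[OF p]]]
    using b(2) by (simp add: tangent_const[OF Xp p])
  define h where "h q = \<rho> q * l q" for q
  have h: "h \<in> smooth_functions A"
    unfolding smooth_functions_def h_def
    using smooth_near_cutoff[OF \<rho>(1) K(1,3)] l K(2) by auto
  have h0: "h p = 0" by (simp add: h_def l_def)
  have h1: "X p h = -1"
    unfolding h_def tangent_mult[OF Xp smooth_functions_near[OF \<rho>(1) p] l[OF U(2)]]
    using \<open>X p l = -1\<close> \<rho>(2) by (simp add: l_def)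
  have N: "nabla X X \<in> vector_fields A" by (rule nabla_in_vector_fields[OF nabla X X])
  let ?Y = "field_add X (field_scale h (nabla X X))"
  have "?Y \<in> vector_fields A" by (intro field_add_in_vector_fields field_scale_in_vector_fields X N h)
  moreover have "?Y p = X p" by (simp add: field_add_def field_scale_def h0)
  moreover have "nabla X ?Y p = (\<lambda>_. 0)"
    unfolding nabla_add_right[OF nabla X X field_scale_in_vector_fields[OF h N]]
      nabla_Leibniz[OF nabla X N h]
    by (simp add: field_add_def field_scale_def h0 h1)
  ultimately show ?thesis by (rule that)
qed

end

section \<open>Symmetric tensors as fibrewise polynomials\<close>

lemma
  assumes \<tau>: "sym_tensor A r p \<tau>" and vs: "vs \<in> lists (tangent_space A p)" "ws \<in> lists (tangent_space A p)"
    and len: "length vs + Suc (length ws) = r" and v: "v \<in> tangent_space A p"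
  shows sym_tensor_add: "w \<in> tangent_space A p \<Longrightarrow>
      \<tau> (vs @ (\<lambda>f. v f + w f) # ws) = \<tau> (vs @ v # ws) + \<tau> (vs @ w # ws)"
    and sym_tensor_scale: "\<tau> (vs @ (\<lambda>f. c * v f) # ws) = c * \<tau> (vs @ v # ws)"
proof -
  have l: "vs @ v # ws \<in> lists (tangent_space A p)" "length (vs @ v # ws) = r" "length vs < r"
    using vs len v by auto
  show "\<tau> (vs @ (\<lambda>f. v f + w f) # ws) = \<tau> (vs @ v # ws) + \<tau> (vs @ w # ws)"
    if w: "w \<in> tangent_space A p"
  proof -
    have "\<tau> ((vs @ v # ws)[length vs := (\<lambda>f. v f + w f)]) =
        \<tau> ((vs @ v # ws)[length vs := v]) + \<tau> ((vs @ v # ws)[length vs := w])"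
      using \<tau> l v w unfolding sym_tensor_def by blast
    then show ?thesis by simp
  qed
  have "\<tau> ((vs @ v # ws)[length vs := (\<lambda>f. c * v f)]) = c * \<tau> ((vs @ v # ws)[length vs := v])"
    using \<tau> l v unfolding sym_tensor_def by blast
  then show "\<tau> (vs @ (\<lambda>f. c * v f) # ws) = c * \<tau> (vs @ v # ws)" by simp
qed

lemma sym_tensor_sum:
  assumes \<tau>: "sym_tensor A r p \<tau>" and vs: "vs \<in> lists (tangent_space A p)" "ws \<in> lists (tangent_space A p)"
    and len: "length vs + Suc (length ws) = r"
    and I: "finite I" "\<And>i. i \<in> I \<Longrightarrow> v i \<in> tangent_space A p"
  shows "\<tau> (vs @ (\<lambda>f. \<Sum>i\<in>I. c i * v i f) # ws) = (\<Sum>i\<in>I. c i * \<tau> (vs @ v i # ws))"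
  using I
proof (induction I)
  case empty
  show ?case using sym_tensor_scale[OF \<tau> vs len zero_in_tangent_space, of 0] by simp
next
  case (insert j I)
  have "\<tau> (vs @ (\<lambda>f. c j * v j f + (\<Sum>i\<in>I. c i * v i f)) # ws) =
      \<tau> (vs @ (\<lambda>f. c j * v j f) # ws) + \<tau> (vs @ (\<lambda>f. \<Sum>i\<in>I. c i * v i f) # ws)"
    by (rule sym_tensor_add[OF \<tau> vs len]) (use insert.prems in
      \<open>auto intro!: tangent_space_sum tangent_space_scale\<close>)
  then show ?case
    using insert sym_tensor_scale[OF \<tau> vs len, of "v j" "c j"] by simp
qed

text \<open>The inactive arguments \<open>ws\<close> make the induction on the number \<open>k\<close> of moving arguments possible: the
  last moving argument splits into \<open>v\<close> and \<open>t z\<close>, both of which are inactive.\<close>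

lemma sym_tensor_line_derivative:
  assumes \<tau>: "sym_tensor A r p \<tau>" and v: "v \<in> tangent_space A p" and z: "z \<in> tangent_space A p"
  shows "ws \<in> lists (tangent_space A p) \<Longrightarrow> k + length ws = r \<Longrightarrow>
    ((\<lambda>t. \<tau> (replicate k (\<lambda>f. v f + t * z f) @ ws)) has_real_derivative
      (\<Sum>j<k. \<tau> ((replicate k v)[j := z] @ ws))) (at 0)"
proof (induction k arbitrary: ws)
  case (Suc k)
  let ?V = "\<lambda>t f. v f + t * z f"
  have V: "?V t \<in> tangent_space A p" for t by (intro tangent_space_add tangent_space_scale v z)
  have eq: "\<tau> (replicate (Suc k) (?V t) @ ws) =
      \<tau> (replicate k (?V t) @ v # ws) + t * \<tau> (replicate k (?V t) @ z # ws)" for t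
  proof -
    have r: "replicate k (?V t) \<in> lists (tangent_space A p)" using V by auto
    have l: "length (replicate k (?V t)) + Suc (length ws) = r" using Suc.prems by simp
    have "replicate (Suc k) (?V t) @ ws = replicate k (?V t) @ ?V t # ws"
      by (simp add: replicate_app_Cons_same)
    then show ?thesis
      using sym_tensor_add[OF \<tau> r Suc.prems(1) l v tangent_space_scale[OF z]]
        sym_tensor_scale[OF \<tau> r Suc.prems(1) l z] by simp
  qed
  have d1: "((\<lambda>t. \<tau> (replicate k (?V t) @ v # ws)) has_real_derivative
      (\<Sum>j<k. \<tau> ((replicate k v)[j := z] @ v # ws))) (at 0)"
    by (rule Suc.IH) (use Suc.prems v in auto)
  have d2: "((\<lambda>t. \<tau> (replicate k (?V t) @ z # ws)) has_real_derivative
      (\<Sum>j<k. \<tau> ((replicate k v)[j := z] @ z # ws))) (at 0)"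
    by (rule Suc.IH) (use Suc.prems z in auto)
  have "((\<lambda>t. \<tau> (replicate (Suc k) (?V t) @ ws)) has_real_derivative
      (\<Sum>j<k. \<tau> ((replicate k v)[j := z] @ v # ws)) + \<tau> (replicate k v @ z # ws)) (at 0)"
    unfolding eq by (rule derivative_eq_intros d1 d2 refl)+ simp
  moreover have "(\<Sum>j<Suc k. \<tau> ((replicate (Suc k) v)[j := z] @ ws)) =
      (\<Sum>j<k. \<tau> ((replicate k v)[j := z] @ v # ws)) + \<tau> (replicate k v @ z # ws)"
  proof -
    have r: "replicate (Suc k) v = replicate k v @ [v]" by (simp add: replicate_append_same)
    show ?thesis unfolding r by (simp add: list_update_append)
  qed
  ultimately show ?case by simp
qed simp

lemma sym_tensor_field_component_smooth:
  assumes "\<phi> \<in> sym_tensor_fields A r" "(U, x) \<in> A" "bs \<in> lists Basis" "length bs = r" "p \<in> U"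
  shows "smooth_near A p (\<lambda>q. \<phi> q (map (\<lambda>b. coord_vector A (U, x) b q) bs))"
proof -
  have "\<forall>(U, x)\<in>A. \<forall>bs\<in>lists Basis. length bs = r \<longrightarrow>
      (\<forall>p\<in>U. smooth_near A p (\<lambda>q. \<phi> q (map (\<lambda>b. coord_vector A (U, x) b q) bs)))"
    using assms(1) unfolding sym_tensor_fields_def by blast
  from bspec[OF this assms(2)] show ?thesis using assms(3-5) by blast
qed

text \<open>The coordinate expression is a polynomial in the fibre coordinates, with the components of \<open>\<phi>\<close> as
  coefficients. By induction on \<open>k\<close>, the expression with \<open>k\<close> slots filled by the variable vector and
  coordinate vectors in the others is smooth, as expanding one slot lowers \<open>k\<close>.\<close>

lemma smooth_near_tilde:
  assumes \<phi>: "\<phi> \<in> sym_tensor_fields A r" and p: "p \<in> points A" "v \<in> tangent_space A p"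
  shows "smooth_near (tangent_atlas A) (p, v) (tilde r \<phi>)"
proof -
  obtain U x where U: "(U, x) \<in> A" "p \<in> U" using p(1) by (rule chart_at)
  let ?i = "inv_into U x" and ?e = "\<lambda>b q. coord_vector A (U, x) b q" and ?V = "chart_vector A (U, x)"
  have o: "open (x ` U \<times> (UNIV :: 'e set))" using chart_image[OF U(1)] by (intro open_Times) auto
  have "smooth_on (x ` U \<times> UNIV) (\<lambda>z. \<phi> (?i (fst z))
      (replicate k (?V (?i (fst z)) (snd z)) @ map (\<lambda>b. ?e b (?i (fst z))) bs))"
    if "bs \<in> lists Basis" "k + length bs = r" for k bs
    using that
  proof (induction k arbitrary: bs)
    case 0
    then have "smooth_on (x ` U) ((\<lambda>q. \<phi> q (map (\<lambda>b. ?e b q) bs)) \<circ> ?i)"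
      by (intro smooth_near_all_chart[OF U(1)] sym_tensor_field_component_smooth[OF \<phi> U(1)]) auto
    from smooth_on_compose[OF this smooth_on_bounded_linear[OF bounded_linear_fst smooth_on_id[OF o]]]
    show ?case by auto
  next
    case (Suc k)
    have "smooth_on (x ` U \<times> UNIV) (\<lambda>z. \<Sum>b\<in>Basis. (snd z \<bullet> b) * \<phi> (?i (fst z))
      (replicate k (?V (?i (fst z)) (snd z)) @ map (\<lambda>b. ?e b (?i (fst z))) (b # bs)))"
    proof (rule smooth_on_sum[OF o], rule smooth_on_mult)
      fix b :: 'e assume b: "b \<in> Basis"
      show "smooth_on (x ` U \<times> UNIV) (\<lambda>z. snd z \<bullet> b)"
        by (rule smooth_on_bounded_linear[OF bounded_linear_inner_left_comp[OF bounded_linear_snd] smooth_on_id[OF o]])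
      show "smooth_on (x ` U \<times> UNIV) (\<lambda>z. \<phi> (?i (fst z))
          (replicate k (?V (?i (fst z)) (snd z)) @ map (\<lambda>b. ?e b (?i (fst z))) (b # bs)))"
        by (rule Suc.IH) (use Suc.prems b in auto)
    qed
    then show ?case
    proof (rule smooth_on_cong)
      fix z assume "z \<in> x ` U \<times> (UNIV :: 'e set)"
      then obtain q c where q: "q \<in> U" "z = (x q, c)" by auto
      have \<tau>: "sym_tensor A r q (\<phi> q)"
        using \<phi> chart_points[OF U(1) q(1)] by (simp add: sym_tensor_fields_def)
      have "replicate (Suc k) (?V q c) @ map (\<lambda>b. ?e b q) bs =
          replicate k (?V q c) @ (\<lambda>f. \<Sum>b\<in>Basis. (c \<bullet> b) * ?e b q f) # map (\<lambda>b. ?e b q) bs"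
        by (simp add: replicate_app_Cons_same chart_vector_def)
      also have "\<phi> q \<dots> = (\<Sum>b\<in>Basis. (c \<bullet> b) * \<phi> q (replicate k (?V q c) @ ?e b q # map (\<lambda>b. ?e b q) bs))"
        by (rule sym_tensor_sum[OF \<tau>])
          (use Suc.prems chart_vector_in_tangent_space[OF U(1) q(1)] coord_vector_in_tangent_space[OF U(1) q(1)]
            in auto)
      finally show "(\<Sum>b\<in>Basis. (snd z \<bullet> b) * \<phi> (?i (fst z))
          (replicate k (?V (?i (fst z)) (snd z)) @ map (\<lambda>b. ?e b (?i (fst z))) (b # bs))) =
          \<phi> (?i (fst z)) (replicate (Suc k) (?V (?i (fst z)) (snd z)) @ map (\<lambda>b. ?e b (?i (fst z))) bs)"
        using q U by simp
    qed
  qed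
  from this[of "[]" r]
  have "smooth_on (x ` U \<times> UNIV) (\<lambda>z. (1 / fact r) * \<phi> (?i (fst z)) (replicate r (?V (?i (fst z)) (snd z))))"
    by (intro smooth_on_mult smooth_on_const o) simp
  then show ?thesis
    by (rule smooth_near_tangent_atlasI[OF U p(2) imageI[OF U(2)] subset_refl]) (use U in \<open>auto simp: tilde_def\<close>)
qed

end

section \<open>The symmetric derivative along the geodesic spray\<close>

theorem proposition2p14:
  fixes T :: "'a topology" and A :: "('a, 'e::euclidean_space) chart set"
    and nabla :: "'a field \<Rightarrow> 'a field \<Rightarrow> 'a field"
    and r :: nat and \<phi> :: "'a tensor_field"
  assumes "smooth_manifold T A"
    and "connection A nabla"
    and "\<phi> \<in> sym_tensor_fields A r"
  shows "\<forall>u\<in>tangent_bundle A.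
    tilde (Suc r) (sym_deriv A nabla \<phi>) u = geodesic_spray A nabla u (tilde r \<phi>)"
proof
  interpret smooth_manifold T A by fact
  note nabla = assms(2) and \<phi> = assms(3)
  fix u assume "u \<in> tangent_bundle A"
  then obtain p v where u: "u = (p, v)" "p \<in> points A" "v \<in> tangent_space A p"
    by (auto simp: tangent_bundle_def)
  define X where "X = extend A p v"
  have X: "X \<in> vector_fields A" "X p = v" unfolding X_def using extend_vector_field u by auto
  obtain Y where Y: "Y \<in> vector_fields A" "Y p = v" "nabla X Y p = (\<lambda>_. 0)"
    using horizontal_section_exists[OF nabla X(1) u(2)] X(2) by metis
  let ?F = "tilde r \<phi>" and ?z = "nabla X X p"
  have F: "smooth_near (tangent_atlas A) (p, v) ?F" by (rule smooth_near_tilde[OF \<phi> u(2,3)])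
  have z: "?z \<in> tangent_space A p"
    by (rule vector_field_tangent[OF nabla_in_vector_fields[OF nabla X(1) X(1)] u(2)])
  have \<tau>: "sym_tensor A r p (\<phi> p)" using \<phi> u(2) by (simp add: sym_tensor_fields_def)
  let ?S = "\<Sum>j<r. \<phi> p ((replicate r v)[j := ?z])"
  \<comment> \<open>The derivative of \<open>F\<close> in the fibre direction \<open>\<nabla>\<^sub>X X\<close>, computed in two ways.\<close>
  have "((\<lambda>t. ?F (p, \<lambda>f. v f + t * (?z f - nabla X Y p f))) has_real_derivative
      v (\<lambda>q. ?F (q, X q)) - v (\<lambda>q. ?F (q, Y q))) (at 0)"
    using section_derivative_diff[OF nabla X(1) X(1) Y(1) u(2) X(2) Y(2) F] X(2) by simp
  moreover have "((\<lambda>t. ?F (p, \<lambda>f. v f + t * (?z f - nabla X Y p f))) has_real_derivative ?S / fact r) (at 0)"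
    using DERIV_cdivide[OF sym_tensor_line_derivative[OF \<tau> u(3) z, of "[]" r], of "fact r"] Y(3)
    by (simp add: tilde_def)
  ultimately have diff: "v (\<lambda>q. ?F (q, X q)) - v (\<lambda>q. ?F (q, Y q)) = ?S / fact r"
    by (rule DERIV_unique)
  have "geodesic_spray A nabla u ?F = v (\<lambda>q. ?F (q, Y q))"
    unfolding u(1) geodesic_spray_def prod.case
      horizontal_lift_eq[where nabla=nabla and W=X and Y=Y and p=p, OF nabla X(1) Y(1) u(2) Y(2) X(2) Y(3)] differential_def Y(2)
    using F by (simp only: if_True o_def)
  also have "\<dots> = (v (\<lambda>q. \<phi> q (replicate r (X q))) - ?S) / fact r"
  proof -
    obtain U x R G where U: "(U, x) \<in> A" "p \<in> U" "smooth_on R G" "(x p, coord_components x v) \<in> R"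
      "\<And>q c. q \<in> U \<Longrightarrow> ?F (q, chart_vector A (U, x) q c) = G (x q, c)"
      using smooth_near_tangent_atlasE[OF F] by blast
    have "smooth_near A p (\<lambda>q. ?F (q, X q))"
      using section_derivative(1)[OF u(3) X(1) U(1,2,3) _ U(5)] U(4) X(2) by simp
    from tangent_cmult[OF u(3) this, of "fact r"]
    have "v (\<lambda>q. \<phi> q (replicate r (X q))) = fact r * v (\<lambda>q. ?F (q, X q))"
      by (simp add: tilde_def)
    then show ?thesis using diff by (simp add: field_simps)
  qed
  also have "\<dots> = tilde (Suc r) (sym_deriv A nabla \<phi>) u"
  proof -
    \<comment> \<open>All \<open>Suc r\<close> summands of the symmetric derivative coincide, which turns \<open>1 / fact (Suc r)\<close> into \<open>1 / fact r\<close>.\<close>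
    have "tensor_deriv nabla X \<phi> (replicate r X) p = v (\<lambda>q. \<phi> q (replicate r (X q))) - ?S"
      by (simp add: tensor_deriv_def X(2))
    moreover have "take j (replicate (Suc r) X) @ drop (Suc j) (replicate (Suc r) X) = replicate r X"
      if "j < Suc r" for j
      using that by (simp del: replicate_Suc add: replicate_add[symmetric])
    ultimately have "sym_deriv A nabla \<phi> p (replicate (Suc r) v) =
        real (Suc r) * (v (\<lambda>q. \<phi> q (replicate r (X q))) - ?S)"
      by (simp del: replicate_Suc add: sym_deriv_def sym_deriv_on_fields_def X_def[symmetric])
    then show ?thesis unfolding u(1) tilde_def by (simp del: replicate_Suc of_nat_Suc)
  qed
  finally show "tilde (Suc r) (sym_deriv A nabla \<phi>) u = geodesic_spray A nabla u ?F" by simp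
qed

end
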